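(* Let $\mathbb L$ be a projective line candidate with commutative vertex groups satisfying the axioms (Inv), (Comp), (Hex1), (Hex2) and (CR) listed in the context. Fix an object $A_0$ of $\mathbb L$ and let $K=\hom(A_0,A_0)\cup\{0\}$ (disjoint union with one new element $0$). Assume that $K$ carries a field structure with zero element $0$ such that the field multiplication on $K^{*}=K\setminus\{0\}$ equals the composition in $\hom(A_0,A_0)$, and such that for every $x\in K\setminus\{0,1\}$ the element $\Phi(x)$ (defined in the context from the cross ratios of $\mathbb L$) equals $1-x$ computed in the field $K$. Then $\mathbb L$ is isomorphic, as a projective line candidate, to the projective line $P(K^2)$. More precisely, given three distinct objects $X,Y,Z$ of $\mathbb L$, there is a unique isomorphism of projective line candidates $F:\mathbb L\to P(K^2)$ such that $F(X)=[0:1]$, $F(Y)=[1:0]$ and $F(Z)=[1:1]$.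
   Context: **Projective line candidates.** A projective line candidate is a transitive groupoid $\mathbb L$ (for any two objects $A,B$ the set $\hom(A,B)$ is nonempty), having at least three objects, together with, for any two different objects $A\neq B$, a bijection between $\hom(A,B)$ and the set of objects $C$ with $C\neq A$ and $C\neq B$. The object $C$ corresponding to an arrow $A\to B$ is called its label, and the arrow $A\to B$ with label $C$ is written $C:A\to B$ or $A\xrightarrow{C}B$ (so this notation presupposes $A\ne B$, $C\neq A$, $C\neq B$). Composition is written from left to right: $A\xrightarrow{C}B\xrightarrow{D}E$ means first $C:A\to B$, then $D:B\to E$. An isomorphism of projective line candidates is an isomorphism of groupoids $F$ compatible with the labelling, i.e. $F$ sends the arrow $C:A\to B$ to the arrow $F(C):F(A)\to F(B)$. **Scalars.** Elements of $\hom(A,A)$ are called scalars at $A$. The vertex groups $\hom(A,A)$ are assumed commutative; hence conjugation by any arrow $f:A\to B$ (that is, $\mu\mapsto f^{-1}\cdot\mu\cdot f$, composed from left to right) gives an isomorphism $\hom(A,A)\cong\hom(B,B)$ which does not depend on $f$. For scalars $\mu$ at $A$ and $\mu'$ at $B$, write $\mu\equiv\mu'$ if they correspond under this isomorphism. **Cross ratio.** If $A,B,C$ are mutually distinct and $A,B,D$ are mutually distinct, $(A,B;C,D)$ denotes the scalar at $A$ given by the composite $A\xrightarrow{C}B\xrightarrow{D}A$. **Axioms.** - (Inv) For mutually distinct $A,B,C$: $A\xrightarrow{C}B\xrightarrow{C}A$ equals $1_A$. - (Comp) For mutually distinct $A,B,C,D$: $A\xrightarrow{C}B\xrightarrow{C}D$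 equals $A\xrightarrow{C}D$. - (Hex1) For mutually distinct $A,B,C,D$: the composites $A\xrightarrow{C}B\xrightarrow{D}A\xrightarrow{B}C$ and $A\xrightarrow{B}C\xrightarrow{A}D\xrightarrow{B}C$ are equal. - (Hex2) For $A,B,C$ mutually distinct and $A,B',C'$ mutually distinct: the composites $A\xrightarrow{C}B\xrightarrow{A}C\xrightarrow{B}A$ and $A\xrightarrow{C'}B'\xrightarrow{A}C'\xrightarrow{B'}A$ are equal. - (CR) For $A,B,C,D$ mutually distinct and $A',B',C',D'$ mutually distinct: if $(A,B;C,D)\equiv(A',B';C',D')$, then $(A,C;B,D)\equiv(A',C';B',D')$. **The operation $\Phi$.** Under these axioms, every scalar $\mu\neq 1$ at $A$ can be written $\mu=(A,B;C,D)$ with $A,B,C,D$ mutually distinct, and one puts $\Phi(\mu)=(A,C;B,D)$; by (CR) this does not depend on the choice of $B,C,D$. **The projective line $P(K^2)$.** For a field $K$, $P(K^2)$ is the projective line candidate whose objects are the 1-dimensional linear subspaces of $K^2$, whose arrows are the $K$-linear isomorphisms between such subspaces, and where, for distinct $A,B$ and $C\ne A,B$, the arrow $C:A\to B$ is the projection from $A$ to $B$ in the direction $C$, i.e. it sends $a\in A$ to the unique $b\in B$ with $a-b\in C$. Here $[s:t]$ denotes the line spanned by $(s,t)$.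
   Formalization: Uniqueness is claimed (and existence proved) for isomorphisms F that also send each scalar x in hom(A_0,A_0) to multiplication by x on F(A_0); without this, a nontrivial automorphism of K (e.g. for K=F_4) gives a second isomorphism with the same values at X, Y, Z. *)

theory Defs
  imports "HOL-Algebra.Module"
begin

section \<open>Groupoids and projective line candidates\<close>

text \<open>Composition is written in diagrammatic order: \<open>f \<cdot> g\<close> is first \<open>f\<close>, then \<open>g\<close>.
  For mutually distinct objects \<open>A\<close>, \<open>B\<close>, \<open>C\<close>, the term \<open>prj L A C B\<close> is the arrow
  \<open>A \<rightarrow> B\<close> with label \<open>C\<close>. Its value on other triples is irrelevant.\<close>

record ('o, 'a) labelled_groupoid =
  Obj :: "'o set"
  Arr :: "'a set"
  src :: "'a \<Rightarrow> 'o"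
  tgt :: "'a \<Rightarrow> 'o"
  comp :: "'a \<Rightarrow> 'a \<Rightarrow> 'a"  (infixl \<open>\<cdot>\<index>\<close> 70)
  idn :: "'o \<Rightarrow> 'a"
  prj :: "'o \<Rightarrow> 'o \<Rightarrow> 'o \<Rightarrow> 'a"

definition Hom :: "('o, 'a, 'm) labelled_groupoid_scheme \<Rightarrow> 'o \<Rightarrow> 'o \<Rightarrow> 'a set"
  where "Hom L A B = {f \<in> Arr L. src L f = A \<and> tgt L f = B}"

definition arr_inv :: "('o, 'a, 'm) labelled_groupoid_scheme \<Rightarrow> 'a \<Rightarrow> 'a"
  where "arr_inv L f = (THE g. g \<in> Hom L (tgt L f) (src L f) \<and>
           f \<cdot>\<^bsub>L\<^esub> g = idn L (src L f) \<and> g \<cdot>\<^bsub>L\<^esub> f = idn L (tgt L f))"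

locale groupoid =
  fixes L (structure)
  assumes src_closed: "f \<in> Arr L \<Longrightarrow> src L f \<in> Obj L"
    and tgt_closed: "f \<in> Arr L \<Longrightarrow> tgt L f \<in> Obj L"
    and idn_closed: "A \<in> Obj L \<Longrightarrow> idn L A \<in> Hom L A A"
    and comp_closed: "f \<in> Hom L A B \<Longrightarrow> g \<in> Hom L B C \<Longrightarrow> f \<cdot> g \<in> Hom L A C"
    and comp_assoc: "f \<in> Hom L A B \<Longrightarrow> g \<in> Hom L B C \<Longrightarrow> h \<in> Hom L C D \<Longrightarrow>
           (f \<cdot> g) \<cdot> h = f \<cdot> (g \<cdot> h)"
    and idn_left: "f \<in> Hom L A B \<Longrightarrow> idn L A \<cdot> f = f"
    and idn_right: "f \<in> Hom L A B \<Longrightarrow> f \<cdot> idn L B = f"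
    and inverse_ex: "f \<in> Hom L A B \<Longrightarrow> \<exists>g \<in> Hom L B A. f \<cdot> g = idn L A \<and> g \<cdot> f = idn L B"

locale projective_line_candidate = groupoid +
  assumes transitive: "A \<in> Obj L \<Longrightarrow> B \<in> Obj L \<Longrightarrow> Hom L A B \<noteq> {}"
    and three_objects: "\<exists>A B C. {A, B, C} \<subseteq> Obj L \<and> distinct [A, B, C]"
    and labelling: "A \<in> Obj L \<Longrightarrow> B \<in> Obj L \<Longrightarrow> A \<noteq> B \<Longrightarrow>
           bij_betw (\<lambda>C. prj L A C B) (Obj L - {A, B}) (Hom L A B)"


section \<open>Scalars and cross ratios\<close>

text \<open>For commutative vertex groups in a transitive groupoid the conjugate of \<open>\<mu>\<close> by \<open>f\<close> does
  not depend on \<open>f : A \<rightarrow> B\<close>, so that existential and universal quantification over \<open>f\<close> agree.\<close>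

definition scalar_equiv ::
    "('o, 'a, 'm) labelled_groupoid_scheme \<Rightarrow> 'o \<Rightarrow> 'a \<Rightarrow> 'o \<Rightarrow> 'a \<Rightarrow> bool"
  where "scalar_equiv L A \<mu> B \<mu>' \<longleftrightarrow> \<mu> \<in> Hom L A A \<and> \<mu>' \<in> Hom L B B \<and>
           (\<exists>f \<in> Hom L A B. (arr_inv L f \<cdot>\<^bsub>L\<^esub> \<mu>) \<cdot>\<^bsub>L\<^esub> f = \<mu>')"

definition cross_ratio ::
    "('o, 'a, 'm) labelled_groupoid_scheme \<Rightarrow> 'o \<Rightarrow> 'o \<Rightarrow> 'o \<Rightarrow> 'o \<Rightarrow> 'a"
  where "cross_ratio L A B C D = prj L A C B \<cdot>\<^bsub>L\<^esub> prj L B D A"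

locale abstract_projective_line = projective_line_candidate +
  assumes vertex_comm: "A \<in> Obj L \<Longrightarrow> \<mu> \<in> Hom L A A \<Longrightarrow> \<nu> \<in> Hom L A A \<Longrightarrow> \<mu> \<cdot> \<nu> = \<nu> \<cdot> \<mu>"
    and Inv: "{A, B, C} \<subseteq> Obj L \<Longrightarrow> distinct [A, B, C] \<Longrightarrow>
           prj L A C B \<cdot> prj L B C A = idn L A"
    and Comp: "{A, B, C, D} \<subseteq> Obj L \<Longrightarrow> distinct [A, B, C, D] \<Longrightarrow>
           prj L A C B \<cdot> prj L B C D = prj L A C D"
    and Hex1: "{A, B, C, D} \<subseteq> Obj L \<Longrightarrow> distinct [A, B, C, D] \<Longrightarrow>
           prj L A C B \<cdot> prj L B D A \<cdot> prj L A B C = prj L A B C \<cdot> prj L C A D \<cdot> prj L D B C"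
    and Hex2: "{A, B, C, B', C'} \<subseteq> Obj L \<Longrightarrow> distinct [A, B, C] \<Longrightarrow> distinct [A, B', C'] \<Longrightarrow>
           prj L A C B \<cdot> prj L B A C \<cdot> prj L C B A = prj L A C' B' \<cdot> prj L B' A C' \<cdot> prj L C' B' A"
    and CR: "{A, B, C, D, A', B', C', D'} \<subseteq> Obj L \<Longrightarrow>
           distinct [A, B, C, D] \<Longrightarrow> distinct [A', B', C', D'] \<Longrightarrow>
           scalar_equiv L A (cross_ratio L A B C D) A' (cross_ratio L A' B' C' D') \<Longrightarrow>
           scalar_equiv L A (cross_ratio L A C B D) A' (cross_ratio L A' C' B' D')"

text \<open>The operation \<open>\<Phi>\<close> on scalars at \<open>A\<close>. In an abstract projective line the described value
  exists and is unique for every scalar \<open>\<mu>\<close> at \<open>A\<close> other than the identity.\<close>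

definition Phi :: "('o, 'a, 'm) labelled_groupoid_scheme \<Rightarrow> 'o \<Rightarrow> 'a \<Rightarrow> 'a"
  where "Phi L A \<mu> = (THE \<nu>. \<exists>B C D. {B, C, D} \<subseteq> Obj L \<and> distinct [A, B, C, D] \<and>
           \<mu> = cross_ratio L A B C D \<and> \<nu> = cross_ratio L A C B D)"


section \<open>Isomorphisms\<close>

text \<open>An isomorphism is a pair of an object map and an arrow map. The maps are required to be
  extensional, so that two isomorphisms are equal as soon as they agree on objects and arrows.\<close>

definition plc_iso ::
    "('o, 'a, 'm) labelled_groupoid_scheme \<Rightarrow> ('p, 'b, 'n) labelled_groupoid_scheme \<Rightarrow>
      (('o \<Rightarrow> 'p) \<times> ('a \<Rightarrow> 'b)) set"
  where "plc_iso L M = {(F, G).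
     F \<in> extensional (Obj L) \<and> bij_betw F (Obj L) (Obj M) \<and>
     G \<in> extensional (Arr L) \<and> bij_betw G (Arr L) (Arr M) \<and>
     (\<forall>f \<in> Arr L. src M (G f) = F (src L f) \<and> tgt M (G f) = F (tgt L f)) \<and>
     (\<forall>A \<in> Obj L. G (idn L A) = idn M (F A)) \<and>
     (\<forall>f \<in> Arr L. \<forall>g \<in> Arr L. tgt L f = src L g \<longrightarrow> G (f \<cdot>\<^bsub>L\<^esub> g) = G f \<cdot>\<^bsub>M\<^esub> G g) \<and>
     (\<forall>A B C. {A, B, C} \<subseteq> Obj L \<and> distinct [A, B, C] \<longrightarrow>
        G (prj L A C B) = prj M (F A) (F C) (F B))}"


section \<open>The projective line over a field\<close>

text \<open>The \<open>K\<close>-module \<open>K\<^sup>2\<close>. The record type also demands the two multiplicative fields; they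
  play no role.\<close>

definition plane :: "('k, 'm) ring_scheme \<Rightarrow> ('k, 'k \<times> 'k) module"
  where "plane K = \<lparr>
     carrier = carrier K \<times> carrier K,
     mult = (\<lambda>(a, b) (c, d). (a \<otimes>\<^bsub>K\<^esub> c, b \<otimes>\<^bsub>K\<^esub> d)),
     one = (\<one>\<^bsub>K\<^esub>, \<one>\<^bsub>K\<^esub>),
     zero = (\<zero>\<^bsub>K\<^esub>, \<zero>\<^bsub>K\<^esub>),
     add = (\<lambda>(a, b) (c, d). (a \<oplus>\<^bsub>K\<^esub> c, b \<oplus>\<^bsub>K\<^esub> d)),
     smult = (\<lambda>r (a, b). (r \<otimes>\<^bsub>K\<^esub> a, r \<otimes>\<^bsub>K\<^esub> b))\<rparr>"

definition span1 :: "('k, 'm) ring_scheme \<Rightarrow> 'k \<times> 'k \<Rightarrow> ('k \<times> 'k) set"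
  where "span1 K v = {r \<odot>\<^bsub>plane K\<^esub> v | r. r \<in> carrier K}"

definition lines :: "('k, 'm) ring_scheme \<Rightarrow> ('k \<times> 'k) set set"
  where "lines K = {span1 K v | v. v \<in> carrier (plane K) \<and> v \<noteq> \<zero>\<^bsub>plane K\<^esub>}"

definition linear_isos ::
    "('k, 'm) ring_scheme \<Rightarrow> ('k \<times> 'k) set \<Rightarrow> ('k \<times> 'k) set \<Rightarrow> ('k \<times> 'k \<Rightarrow> 'k \<times> 'k) set"
  where "linear_isos K A B = {h. h \<in> extensional A \<and> bij_betw h A B \<and>
     (\<forall>x \<in> A. \<forall>y \<in> A. h (x \<oplus>\<^bsub>plane K\<^esub> y) = h x \<oplus>\<^bsub>plane K\<^esub> h y) \<and>
     (\<forall>r \<in> carrier K. \<forall>x \<in> A. h (r \<odot>\<^bsub>plane K\<^esub> x) = r \<odot>\<^bsub>plane K\<^esub> h x)}"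

text \<open>An arrow is a triple of its source, the underlying (extensional) map and its target.\<close>

definition proj_line ::
    "('k, 'm) ring_scheme \<Rightarrow>
      (('k \<times> 'k) set,
       ('k \<times> 'k) set \<times> ('k \<times> 'k \<Rightarrow> 'k \<times> 'k) \<times> ('k \<times> 'k) set) labelled_groupoid"
  where "proj_line K = \<lparr>
     Obj = lines K,
     Arr = {(A, h, B) | A h B. A \<in> lines K \<and> B \<in> lines K \<and> h \<in> linear_isos K A B},
     src = (\<lambda>(A, h, B). A),
     tgt = (\<lambda>(A, h, B). B),
     comp = (\<lambda>(A, h, B) (B', k, C). (A, compose A k h, C)),
     idn = (\<lambda>A. (A, (\<lambda>a\<in>A. a), A)),
     prj = (\<lambda>A C B. (A, (\<lambda>a\<in>A. THE b. b \<in> B \<and> a \<ominus>\<^bsub>plane K\<^esub> b \<in> C), B))\<rparr>"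

text \<open>The scalar \<open>r \<noteq> 0\<close> at the line \<open>A\<close>, i.e. multiplication by \<open>r\<close> on \<open>A\<close>. It
  expresses that an isomorphism onto \<open>proj_line K\<close> is one over \<open>K\<close>. This is needed for uniqueness:
  a nontrivial automorphism of \<open>K\<close>, applied to both coordinates, induces a label-preserving
  automorphism of \<open>proj_line K\<close> that fixes \<open>[0:1]\<close>, \<open>[1:0]\<close> and \<open>[1:1]\<close> but is not the identity.\<close>

definition homothety ::
    "('k, 'm) ring_scheme \<Rightarrow> 'k \<Rightarrow> ('k \<times> 'k) set \<Rightarrow>
      ('k \<times> 'k) set \<times> ('k \<times> 'k \<Rightarrow> 'k \<times> 'k) \<times> ('k \<times> 'k) set"
  where "homothety K r A = (A, (\<lambda>a\<in>A. r \<odot>\<^bsub>plane K\<^esub> a), A)"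

end

theory Submission
  imports Defs "HOL-Algebra.Multiplicative_Group"
begin

text \<open>A frame, that is a choice of an arrow \<open>e A : A0 \<rightarrow> A\<close> for every object \<open>A\<close>, assigns to every
  arrow \<open>f : A \<rightarrow> B\<close> the scalar \<open>e A \<cdot> f \<cdot> (e B)\<^sup>-\<^sup>1\<close> at \<open>A0\<close>, its weight. Weights are multiplicative
  and determine an arrow with given ends, so a projective line candidate is known as soon as
  the weights \<open>c(A, C, B)\<close> of the labelled arrows \<open>C : A \<rightarrow> B\<close> are known for some frame. In \<open>P(K\<^sup>2)\<close> a
  spanning vector \<open>v\<^sub>A\<close> of each line plays the part of a frame, and
  \<open>c(A, C, B) = det(v\<^sub>A, v\<^sub>C) / det(v\<^sub>B, v\<^sub>C)\<close> (\<open>prj_eq_scale_arrow\<close>). The existence of an isomorphism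
  therefore amounts to finding a frame of \<open>L\<close> and vectors \<open>v\<^sub>A\<close> for which the weights in \<open>L\<close> are
  these quotients (\<open>coef_det\<close>).

  Axiom (CR) carries the assumption \<open>\<Phi>(x) = 1 - x\<close> to all objects: the weights of \<open>(A, B; C, D)\<close>
  and \<open>(A, C; B, D)\<close> add up to \<open>1\<close> (\<open>wt_cross_ratio_add\<close>). Choose the frame so that
  \<open>c(Y, X, D) = 1\<close> for \<open>D\<close> other than \<open>X\<close>, \<open>Y\<close> and \<open>c(Y, Z, X) = -1\<close>, and put \<open>v\<^sub>X = (0, 1)\<close>, \<open>v\<^sub>Y = (1, 0)\<close> and
  \<open>v\<^sub>D = (1, m\<^sub>D)\<close> with \<open>m\<^sub>D = - c(Y, D, X)\<close> for all other \<open>D\<close>. For a fixed label, (Inv) and (Comp)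
  reduce the quotient formula to arrows with a single source (\<open>coef_by_det_pivot\<close>). For the label
  \<open>X\<close> it is then the normalisation of the frame; for other labels it follows from the additive
  relation, in which all weights but one are known (\<open>coef_to_Y\<close>, \<open>coef_Y_to_X\<close>); if \<open>L\<close> has only
  three objects, \<open>K\<close> has only one nonzero element and the formula for the label \<open>Y\<close> is trivial.
  Since the labelling is bijective, \<open>m\<^sub>D\<close> takes every nonzero value exactly once,
  and the vectors \<open>v\<^sub>D\<close> span each line of \<open>K\<^sup>2\<close> exactly once.

  For uniqueness, two isomorphisms differ by an endomorphism of \<open>L\<close> that fixes \<open>X\<close>, \<open>Y\<close>, \<open>Z\<close> and
  the weights of the scalars at \<open>A0\<close>. It then fixes the weights of all scalars, among them
  \<open>(X, Y; Z, D)\<close>, which determines \<open>D\<close> (\<open>endo_trivial_if_weight_fixed\<close>).\<close>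

section \<open>Frames of a transitive groupoid\<close>

context groupoid
begin

lemma Hom_objects:
  assumes "f \<in> Hom L A B"
  shows "A \<in> Obj L" "B \<in> Obj L"
  using assms src_closed tgt_closed by (auto simp: Hom_def)

lemma arr_inv_props:
  assumes f: "f \<in> Hom L A B"
  shows arr_inv_closed: "arr_inv L f \<in> Hom L B A"
    and arr_inv_right: "f \<cdot> arr_inv L f = idn L A"
    and arr_inv_left: "arr_inv L f \<cdot> f = idn L B"
proof -
  obtain g where g: "g \<in> Hom L B A" "f \<cdot> g = idn L A" "g \<cdot> f = idn L B"
    using inverse_ex[OF f] by blast
  have st: "src L f = A" "tgt L f = B"
    using f by (auto simp: Hom_def)
  have "arr_inv L f = g"
    unfolding arr_inv_def st
  proof (rule the_equality)
    fix h assume h: "h \<in> Hom L B A \<and> f \<cdot> h = idn L A \<and> h \<cdot> f = idn L B"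
    have "h = h \<cdot> (f \<cdot> g)" using h g idn_right by metis
    also have "\<dots> = (h \<cdot> f) \<cdot> g" using h g f comp_assoc by metis
    also have "\<dots> = g" using h g idn_left by metis
    finally show "h = g" .
  qed (use g in auto)
  then show "arr_inv L f \<in> Hom L B A" "f \<cdot> arr_inv L f = idn L A" "arr_inv L f \<cdot> f = idn L B"
    using g by auto
qed

lemma cancel_left:
  assumes f: "f \<in> Hom L A B" and g: "g \<in> Hom L B C" and h: "h \<in> Hom L B C"
    and eq: "f \<cdot> g = f \<cdot> h"
  shows "g = h"
proof -
  note i = arr_inv_props[OF f]
  have "g = arr_inv L f \<cdot> (f \<cdot> g)"
    using comp_assoc[OF i(1) f g] i(3) idn_left[OF g] by simp
  also have "\<dots> = h"
    using comp_assoc[OF i(1) f h] i(3) idn_left[OF h] eq by simp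
  finally show ?thesis .
qed

end

text \<open>A frame chooses an arrow \<open>e A : A0 \<rightarrow> A\<close> at every object. Conjugating with it turns each
  arrow into a scalar at \<open>A0\<close>, so that the whole groupoid can be studied inside one group.\<close>

definition frame_weight :: "('o, 'a, 'm) labelled_groupoid_scheme \<Rightarrow> ('o \<Rightarrow> 'a) \<Rightarrow> 'a \<Rightarrow> 'a"
  where "frame_weight L e f = e (src L f) \<cdot>\<^bsub>L\<^esub> f \<cdot>\<^bsub>L\<^esub> arr_inv L (e (tgt L f))"

locale framed_groupoid = groupoid +
  fixes A0 and e
  assumes frame: "A \<in> Obj L \<Longrightarrow> e A \<in> Hom L A0 A"
begin

lemma frame_weight_closed:
  assumes f: "f \<in> Hom L A B"
  shows "frame_weight L e f \<in> Hom L A0 A0"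
proof -
  have st: "src L f = A" "tgt L f = B"
    using f by (auto simp: Hom_def)
  have e: "e A \<in> Hom L A0 A" "e B \<in> Hom L A0 B"
    using f frame Hom_objects by auto
  show ?thesis
    unfolding frame_weight_def st
    by (rule comp_closed[OF comp_closed[OF e(1) f] arr_inv_closed[OF e(2)]])
qed

text \<open>The weight measures by how much \<open>f\<close> fails to carry the frame at \<open>A\<close> to the frame at \<open>B\<close>.
  Every computation of a weight below uses this inverse-free form.\<close>

lemma frame_weight_eq_iff:
  assumes f: "f \<in> Hom L A B" and \<mu>: "\<mu> \<in> Hom L A0 A0"
  shows "frame_weight L e f = \<mu> \<longleftrightarrow> e A \<cdot> f = \<mu> \<cdot> e B"
proof -
  have st: "src L f = A" "tgt L f = B"
    using f by (auto simp: Hom_def)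
  have eA: "e A \<in> Hom L A0 A" and eB: "e B \<in> Hom L A0 B"
    using f frame Hom_objects by auto
  have ef: "e A \<cdot> f \<in> Hom L A0 B"
    using eA f by (rule comp_closed)
  note i = arr_inv_props[OF eB]
  have "(e A \<cdot> f \<cdot> arr_inv L (e B)) \<cdot> e B = e A \<cdot> f"
    using comp_assoc[OF ef i(1) eB] i(3) idn_right[OF ef] by simp
  moreover have "(\<mu> \<cdot> e B) \<cdot> arr_inv L (e B) = \<mu>"
    using comp_assoc[OF \<mu> eB i(1)] i(2) idn_right[OF \<mu>] by simp
  ultimately show ?thesis
    unfolding frame_weight_def st by metis
qed

lemma frame_weight:
  assumes "f \<in> Hom L A B"
  shows "e A \<cdot> f = frame_weight L e f \<cdot> e B"
  using frame_weight_eq_iff[OF assms frame_weight_closed[OF assms]] by simp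

lemma frame_weight_comp:
  assumes f: "f \<in> Hom L A B" and g: "g \<in> Hom L B C"
  shows "frame_weight L e (f \<cdot> g) = frame_weight L e f \<cdot> frame_weight L e g"
proof -
  let ?w = "frame_weight L e"
  have e: "e A \<in> Hom L A0 A" "e B \<in> Hom L A0 B" "e C \<in> Hom L A0 C"
    using f g frame Hom_objects by auto
  note w = frame_weight_closed[OF f] frame_weight_closed[OF g]
  have "e A \<cdot> (f \<cdot> g) = (?w f \<cdot> e B) \<cdot> g"
    using comp_assoc[OF e(1) f g] frame_weight[OF f] by simp
  also have "\<dots> = ?w f \<cdot> (?w g \<cdot> e C)"
    using comp_assoc[OF w(1) e(2) g] frame_weight[OF g] by simp
  also have "\<dots> = (?w f \<cdot> ?w g) \<cdot> e C"
    using comp_assoc[OF w e(3)] by simp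
  finally show ?thesis
    using frame_weight_eq_iff[OF comp_closed[OF f g] comp_closed[OF w]] by simp
qed

lemma frame_weight_bij:
  assumes A: "A \<in> Obj L" and B: "B \<in> Obj L"
  shows "bij_betw (frame_weight L e) (Hom L A B) (Hom L A0 A0)"
proof -
  note eA = frame[OF A] and eB = frame[OF B]
  note i = arr_inv_props[OF eA]
  have "inj_on (frame_weight L e) (Hom L A B)"
  proof (rule inj_onI)
    fix f g assume fg: "f \<in> Hom L A B" "g \<in> Hom L A B"
      and eq: "frame_weight L e f = frame_weight L e g"
    have "e A \<cdot> f = e A \<cdot> g"
      using frame_weight[OF fg(1)] frame_weight[OF fg(2)] eq by simp
    then show "f = g" by (rule cancel_left[OF eA fg])
  qed
  moreover have "\<mu> \<in> frame_weight L e ` Hom L A B" if \<mu>: "\<mu> \<in> Hom L A0 A0" for \<mu>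
  proof -
    note m = comp_closed[OF \<mu> eB]
    let ?f = "arr_inv L (e A) \<cdot> (\<mu> \<cdot> e B)"
    have f: "?f \<in> Hom L A B" using i(1) m by (rule comp_closed)
    have "e A \<cdot> ?f = \<mu> \<cdot> e B"
      using comp_assoc[OF eA i(1) m] i(2) idn_left[OF m] by simp
    then have "frame_weight L e ?f = \<mu>" using frame_weight_eq_iff[OF f \<mu>] by simp
    then show ?thesis using f by (intro image_eqI[where x = ?f]) simp_all
  qed
  moreover have "frame_weight L e ` Hom L A B \<subseteq> Hom L A0 A0"
    using frame_weight_closed by blast
  ultimately show ?thesis
    unfolding bij_betw_def by blast
qed

text \<open>At \<open>A0\<close> the weight is conjugation by the scalar \<open>e A0\<close>, hence trivial when the vertex
  group is commutative. This ties weights to the given field elements, whichever frame is used.\<close>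

lemma frame_weight_vertex:
  assumes comm: "\<And>\<mu> \<nu>. \<mu> \<in> Hom L A0 A0 \<Longrightarrow> \<nu> \<in> Hom L A0 A0 \<Longrightarrow> \<mu> \<cdot> \<nu> = \<nu> \<cdot> \<mu>"
    and \<mu>: "\<mu> \<in> Hom L A0 A0"
  shows "frame_weight L e \<mu> = \<mu>"
  using frame_weight_eq_iff[OF \<mu> \<mu>] comm[OF frame \<mu>] Hom_objects[OF \<mu>] by blast

text \<open>The conjugation that identifies scalars at \<open>A\<close> with scalars at \<open>B\<close> multiplies the weight by
  that of an arrow and of its inverse, which cancel by commutativity.\<close>

lemma scalar_equiv_iff_frame_weight:
  assumes comm: "\<And>\<mu> \<nu>. \<mu> \<in> Hom L A0 A0 \<Longrightarrow> \<nu> \<in> Hom L A0 A0 \<Longrightarrow> \<mu> \<cdot> \<nu> = \<nu> \<cdot> \<mu>"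
    and \<mu>: "\<mu> \<in> Hom L A A" and \<nu>: "\<nu> \<in> Hom L B B"
  shows "scalar_equiv L A \<mu> B \<nu> \<longleftrightarrow> frame_weight L e \<mu> = frame_weight L e \<nu>"
proof -
  let ?w = "frame_weight L e"
  have AB: "A \<in> Obj L" "B \<in> Obj L" using \<mu> \<nu> Hom_objects by auto
  have conj: "(arr_inv L f \<cdot> \<mu>) \<cdot> f = \<nu> \<longleftrightarrow> ?w \<mu> = ?w \<nu>" if f: "f \<in> Hom L A B" for f
  proof -
    note i = arr_inv_props[OF f]
    note p = comp_closed[OF i(1) \<mu>]
    note q = comp_closed[OF p f]
    have "f \<cdot> ((arr_inv L f \<cdot> \<mu>) \<cdot> f) = \<mu> \<cdot> f"
      using comp_assoc[OF f i(1) \<mu>] comp_assoc[OF f p f] i(2) idn_left[OF \<mu>] by simp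
    then have "(arr_inv L f \<cdot> \<mu>) \<cdot> f = \<nu> \<longleftrightarrow> \<mu> \<cdot> f = f \<cdot> \<nu>"
      using cancel_left[OF f q \<nu>] by metis
    also have "\<dots> \<longleftrightarrow> ?w (\<mu> \<cdot> f) = ?w (f \<cdot> \<nu>)"
      using frame_weight_bij[OF AB] comp_closed[OF \<mu> f] comp_closed[OF f \<nu>]
      by (auto simp: bij_betw_def inj_on_def)
    also have "\<dots> \<longleftrightarrow> ?w f \<cdot> ?w \<mu> = ?w f \<cdot> ?w \<nu>"
      using frame_weight_comp[OF \<mu> f] frame_weight_comp[OF f \<nu>]
        comm[OF frame_weight_closed[OF \<mu>] frame_weight_closed[OF f]] by simp
    also have "\<dots> \<longleftrightarrow> ?w \<mu> = ?w \<nu>"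
      using cancel_left frame_weight_closed f \<mu> \<nu> by metis
    finally show ?thesis .
  qed
  have "Hom L A B \<noteq> {}"
    using frame_weight_bij[OF AB] idn_closed Hom_objects(1)[OF frame[OF AB(1)]]
    by (metis bij_betw_empty1 empty_iff)
  then show ?thesis unfolding scalar_equiv_def using conj \<mu> \<nu> by blast
qed

end

section \<open>Arrows of the projective line over a field\<close>

text \<open>Vanishing of the determinant characterises membership in a line, so that projections can be
  computed by linear equations with \<open>det2\<close> as coefficients.\<close>

definition det2 :: "('k, 'm) ring_scheme \<Rightarrow> 'k \<times> 'k \<Rightarrow> 'k \<times> 'k \<Rightarrow> 'k"
  where "det2 K v w = fst v \<otimes>\<^bsub>K\<^esub> snd w \<ominus>\<^bsub>K\<^esub> snd v \<otimes>\<^bsub>K\<^esub> fst w"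

text \<open>The linear map from the line of \<open>v\<close> to the line of \<open>w\<close> that sends \<open>v\<close> to \<open>r w\<close>, as an arrow.
  The description operator picks out the coordinate of a point \<open>a\<close> with respect to \<open>v\<close>; it is
  meaningful for \<open>v \<noteq> 0\<close> only. The number \<open>r\<close> is the weight of this arrow for the frame given
  by the chosen spanning vectors.\<close>

definition scale_arrow where
  "scale_arrow K v r w = (span1 K v,
     (\<lambda>a \<in> span1 K v. ((THE s. s \<in> carrier K \<and> a = s \<odot>\<^bsub>plane K\<^esub> v) \<otimes>\<^bsub>K\<^esub> r) \<odot>\<^bsub>plane K\<^esub> w),
     span1 K w)"

context field
begin

lemma plane_simps:
  "carrier (plane R) = carrier R \<times> carrier R"
  "\<zero>\<^bsub>plane R\<^esub> = (\<zero>, \<zero>)"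
  "v \<oplus>\<^bsub>plane R\<^esub> w = (fst v \<oplus> fst w, snd v \<oplus> snd w)"
  "s \<odot>\<^bsub>plane R\<^esub> v = (s \<otimes> fst v, s \<otimes> snd v)"
  by (simp_all add: plane_def case_prod_beta)

abbreviation nonzero_vec where "nonzero_vec v \<equiv> v \<in> carrier (plane R) - {\<zero>\<^bsub>plane R\<^esub>}"

lemma nonzero_vec_iff:
  "nonzero_vec v \<longleftrightarrow> fst v \<in> carrier R \<and> snd v \<in> carrier R \<and> (fst v \<noteq> \<zero> \<or> snd v \<noteq> \<zero>)"
  by (cases v) (auto simp: plane_simps)

text \<open>Subtraction in \<open>plane R\<close> is defined through a description of the additive inverse, so its
  componentwise form depends on the plane being an abelian group.\<close>

lemma plane_minus:
  assumes v: "v \<in> carrier (plane R)" and w: "w \<in> carrier (plane R)"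
  shows "v \<ominus>\<^bsub>plane R\<^esub> w = (fst v \<ominus> fst w, snd v \<ominus> snd w)"
proof -
  interpret P: abelian_group "plane R"
  proof (rule abelian_groupI)
    fix x assume x: "x \<in> carrier (plane R)"
    then show "\<exists>y \<in> carrier (plane R). y \<oplus>\<^bsub>plane R\<^esub> x = \<zero>\<^bsub>plane R\<^esub>"
      by (intro bexI[where x = "(\<ominus> fst x, \<ominus> snd x)"]) (auto simp: plane_simps l_neg)
  qed (auto simp: plane_simps a_assoc intro: a_comm)
  have "\<ominus>\<^bsub>plane R\<^esub> w = (\<ominus> fst w, \<ominus> snd w)"
    using w by (intro P.minus_equality) (auto simp: plane_simps l_neg)
  then show ?thesis by (simp add: P.minus_eq minus_eq plane_simps)
qed

lemma smult_inject:
  assumes v: "nonzero_vec v" and s: "s \<in> carrier R" and t: "t \<in> carrier R"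
    and eq: "s \<odot>\<^bsub>plane R\<^esub> v = t \<odot>\<^bsub>plane R\<^esub> v"
  shows "s = t"
proof -
  have "s \<otimes> fst v = t \<otimes> fst v" "s \<otimes> snd v = t \<otimes> snd v"
    using eq by (auto simp: plane_simps)
  then show ?thesis
    using v s t m_rcancel unfolding nonzero_vec_iff by blast
qed

lemma span1_iff: "a \<in> span1 R v \<longleftrightarrow> (\<exists>s \<in> carrier R. a = s \<odot>\<^bsub>plane R\<^esub> v)"
  by (auto simp: span1_def)

lemma smult_in_span1: "s \<in> carrier R \<Longrightarrow> s \<odot>\<^bsub>plane R\<^esub> v \<in> span1 R v"
  by (auto simp: span1_iff)

lemma span1_subset:
  assumes "v \<in> carrier (plane R)" "a \<in> span1 R v"
  shows "a \<in> carrier (plane R)"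
  using assms by (auto simp: span1_iff plane_simps)

lemma span1_self: "v \<in> carrier (plane R) \<Longrightarrow> v \<in> span1 R v"
  by (auto simp: span1_iff plane_simps intro!: bexI[where x = \<one>])

lemma lines_iff: "A \<in> lines R \<longleftrightarrow> (\<exists>v. nonzero_vec v \<and> A = span1 R v)"
  by (auto simp: lines_def)

lemma det2_smult:
  assumes "v \<in> carrier (plane R)" "w \<in> carrier (plane R)" "s \<in> carrier R"
  shows "det2 R (s \<odot>\<^bsub>plane R\<^esub> v) w = s \<otimes> det2 R v w"
proof -
  obtain a b c d where "v = (a, b)" "w = (c, d)" by (cases v, cases w)
  moreover have "s \<otimes> a \<otimes> d \<ominus> s \<otimes> b \<otimes> c = s \<otimes> (a \<otimes> d \<ominus> b \<otimes> c)"
    if "a \<in> carrier R" "b \<in> carrier R" "c \<in> carrier R" "d \<in> carrier R"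
    using that assms(3) by algebra
  ultimately show ?thesis
    using assms by (simp add: det2_def plane_simps)
qed

lemma det2_minus:
  assumes "v \<in> carrier (plane R)" "v' \<in> carrier (plane R)" "w \<in> carrier (plane R)"
  shows "det2 R (v \<ominus>\<^bsub>plane R\<^esub> v') w = det2 R v w \<ominus> det2 R v' w"
proof -
  obtain a b a' b' c d where "v = (a, b)" "v' = (a', b')" "w = (c, d)"
    by (cases v, cases v', cases w)
  moreover have "(a \<ominus> a') \<otimes> d \<ominus> (b \<ominus> b') \<otimes> c = a \<otimes> d \<ominus> b \<otimes> c \<ominus> (a' \<otimes> d \<ominus> b' \<otimes> c)"
    if "a \<in> carrier R" "b \<in> carrier R" "a' \<in> carrier R" "b' \<in> carrier R"
      "c \<in> carrier R" "d \<in> carrier R"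
    using that by algebra
  ultimately show ?thesis
    using assms plane_minus[OF assms(1,2)] by (simp add: det2_def plane_simps)
qed

lemma det2_in_carrier:
  assumes "v \<in> carrier (plane R)" "w \<in> carrier (plane R)"
  shows "det2 R v w \<in> carrier R"
  using assms by (auto simp: det2_def plane_simps)

lemma mem_span1_iff_det2:
  assumes v: "nonzero_vec v" and a: "a \<in> carrier (plane R)"
  shows "a \<in> span1 R v \<longleftrightarrow> det2 R a v = \<zero>"
proof
  assume "a \<in> span1 R v"
  then obtain s where s: "s \<in> carrier R" "a = s \<odot>\<^bsub>plane R\<^esub> v" by (auto simp: span1_iff)
  obtain x y where "v = (x, y)" by (cases v)
  then have "det2 R v v = \<zero>"
    using v by (simp add: det2_def plane_simps m_comm minus_eq r_neg)
  then show "det2 R a v = \<zero>"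
    using det2_smult[of v v s] s v by simp
next
  assume 0: "det2 R a v = \<zero>"
  obtain x y where xy: "v = (x, y)" by (cases v)
  obtain b c where bc: "a = (b, c)" by (cases a)
  have cl: "x \<in> carrier R" "y \<in> carrier R" "b \<in> carrier R" "c \<in> carrier R"
    using v a xy bc by (auto simp: plane_simps)
  have eq: "b \<otimes> y = c \<otimes> x"
    using 0 cl by (simp add: det2_def xy bc)
  show "a \<in> span1 R v"
  proof (cases "x = \<zero>")
    case False
    then have i: "inv x \<in> carrier R" "x \<otimes> inv x = \<one>" "inv x \<otimes> x = \<one>"
      using cl field_Units by auto
    have "b = b \<otimes> inv x \<otimes> x"
      using cl i by (simp add: m_assoc)
    moreover have "c = (b \<otimes> inv x) \<otimes> y"
    proof -
      have "(b \<otimes> inv x) \<otimes> y = (b \<otimes> y) \<otimes> inv x" using cl i(1) by algebra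
      also have "\<dots> = c" using eq cl i by (simp add: m_assoc)
      finally show ?thesis by simp
    qed
    ultimately show ?thesis
      using cl i(1) by (auto simp: span1_iff xy bc plane_simps intro!: bexI[where x = "b \<otimes> inv x"])
  next
    case True
    then have y: "y \<noteq> \<zero>" using v by (auto simp: xy plane_simps)
    then have i: "inv y \<in> carrier R" "inv y \<otimes> y = \<one>"
      using cl field_Units by auto
    have "b = \<zero>" using eq cl True y by (auto simp: integral_iff)
    moreover have "c = c \<otimes> inv y \<otimes> y"
      using cl i by (simp add: m_assoc)
    ultimately show ?thesis
      using cl i True by (auto simp: span1_iff xy bc plane_simps intro!: bexI[where x = "c \<otimes> inv y"])
  qed
qed

lemma det2_antisym:
  assumes "v \<in> carrier (plane R)" "w \<in> carrier (plane R)"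
  shows "det2 R w v = \<ominus> det2 R v w"
proof -
  obtain a b c d where "v = (a, b)" "w = (c, d)" by (cases v, cases w)
  moreover have "c \<otimes> b \<ominus> d \<otimes> a = \<ominus> (a \<otimes> d \<ominus> b \<otimes> c)"
    if "a \<in> carrier R" "b \<in> carrier R" "c \<in> carrier R" "d \<in> carrier R"
    using that by algebra
  ultimately show ?thesis using assms by (simp add: det2_def plane_simps)
qed

lemma smult_smult:
  assumes "v \<in> carrier (plane R)" "s \<in> carrier R" "t \<in> carrier R"
  shows "s \<odot>\<^bsub>plane R\<^esub> (t \<odot>\<^bsub>plane R\<^esub> v) = (s \<otimes> t) \<odot>\<^bsub>plane R\<^esub> v"
  using assms by (auto simp: plane_simps m_assoc)

lemma smult_l_distr:
  assumes "v \<in> carrier (plane R)" "s \<in> carrier R" "t \<in> carrier R"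
  shows "(s \<oplus> t) \<odot>\<^bsub>plane R\<^esub> v = s \<odot>\<^bsub>plane R\<^esub> v \<oplus>\<^bsub>plane R\<^esub> t \<odot>\<^bsub>plane R\<^esub> v"
  using assms by (auto simp: plane_simps l_distr)

lemma span1_eq_iff_det2:
  assumes v: "nonzero_vec v" and w: "nonzero_vec w"
  shows "span1 R v = span1 R w \<longleftrightarrow> det2 R v w = \<zero>"
proof
  assume "span1 R v = span1 R w"
  then have "v \<in> span1 R w" using span1_self[of v] v by simp
  then show "det2 R v w = \<zero>" using mem_span1_iff_det2[OF w] v by simp
next
  have sub: "span1 R v \<subseteq> span1 R w"
    if "nonzero_vec v" "nonzero_vec w" "det2 R v w = \<zero>" for v w
  proof -
    have "v \<in> span1 R w"
      using mem_span1_iff_det2[of w v] that by simp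
    then obtain s where s: "s \<in> carrier R" "v = s \<odot>\<^bsub>plane R\<^esub> w"
      by (auto simp: span1_iff)
    have "t \<odot>\<^bsub>plane R\<^esub> v \<in> span1 R w" if t: "t \<in> carrier R" for t
      using smult_smult[of w t s] smult_in_span1[of "t \<otimes> s" w] s t \<open>nonzero_vec w\<close> by simp
    then show ?thesis by (auto simp: span1_iff[of _ v])
  qed
  assume "det2 R v w = \<zero>"
  moreover from this have "det2 R w v = \<zero>" using det2_antisym[of v w] v w by simp
  ultimately show "span1 R v = span1 R w" using sub v w by blast
qed

lemma scale_arrow_apply:
  assumes v: "nonzero_vec v" and s: "s \<in> carrier R"
  shows "fst (snd (scale_arrow R v r w)) (s \<odot>\<^bsub>plane R\<^esub> v) = (s \<otimes> r) \<odot>\<^bsub>plane R\<^esub> w"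
proof -
  have "(THE t. t \<in> carrier R \<and> s \<odot>\<^bsub>plane R\<^esub> v = t \<odot>\<^bsub>plane R\<^esub> v) = s"
  proof (rule the_equality)
    fix t assume "t \<in> carrier R \<and> s \<odot>\<^bsub>plane R\<^esub> v = t \<odot>\<^bsub>plane R\<^esub> v"
    then show "t = s" using smult_inject[OF v, of t s] s by simp
  qed (use s in simp)
  moreover have "s \<odot>\<^bsub>plane R\<^esub> v \<in> span1 R v" using s by (auto simp: span1_iff)
  ultimately show ?thesis by (simp add: scale_arrow_def)
qed

lemma scale_arrow_eqI:
  assumes v: "nonzero_vec v" and r: "r \<in> carrier R" and h: "h \<in> extensional (span1 R v)"
    and eq: "\<And>s. s \<in> carrier R \<Longrightarrow> h (s \<odot>\<^bsub>plane R\<^esub> v) = (s \<otimes> r) \<odot>\<^bsub>plane R\<^esub> w"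
  shows "(span1 R v, h, span1 R w) = scale_arrow R v r w"
proof -
  have "h = fst (snd (scale_arrow R v r w))"
  proof (rule extensionalityI[OF h])
    show "fst (snd (scale_arrow R v r w)) \<in> extensional (span1 R v)"
      by (simp add: scale_arrow_def)
    fix a assume "a \<in> span1 R v"
    then obtain s where "s \<in> carrier R" "a = s \<odot>\<^bsub>plane R\<^esub> v" by (auto simp: span1_iff)
    then show "h a = fst (snd (scale_arrow R v r w)) a"
      using eq[of s] scale_arrow_apply[OF v, of s r w] by simp
  qed
  then show ?thesis by (simp add: scale_arrow_def)
qed

lemma scale_arrow_inject:
  assumes v: "nonzero_vec v" and w: "nonzero_vec w" and r: "r \<in> carrier R" and s: "s \<in> carrier R"
    and eq: "scale_arrow R v r w = scale_arrow R v s w"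
  shows "r = s"
proof -
  have "(\<one> \<otimes> r) \<odot>\<^bsub>plane R\<^esub> w = (\<one> \<otimes> s) \<odot>\<^bsub>plane R\<^esub> w"
    using scale_arrow_apply[OF v one_closed, of r w] scale_arrow_apply[OF v one_closed, of s w] eq
    by simp
  then show ?thesis using smult_inject[OF w r s] r s by simp
qed

lemma scale_arrow_closed:
  assumes v: "nonzero_vec v" and w: "nonzero_vec w" and r: "r \<in> carrier R" "r \<noteq> \<zero>"
  shows "scale_arrow R v r w \<in> Hom (proj_line R) (span1 R v) (span1 R w)"
proof -
  define h where "h = fst (snd (scale_arrow R v r w))"
  have h: "h (s \<odot>\<^bsub>plane R\<^esub> v) = (s \<otimes> r) \<odot>\<^bsub>plane R\<^esub> w" if "s \<in> carrier R" for s
    using scale_arrow_apply[OF v that] by (simp add: h_def)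
  have i: "inv r \<in> carrier R" "inv r \<otimes> r = \<one>"
    using r field_Units by auto
  have "inj_on h (span1 R v)"
  proof (rule inj_onI)
    fix a b assume "a \<in> span1 R v" "b \<in> span1 R v" and eq: "h a = h b"
    then obtain s t where st: "s \<in> carrier R" "a = s \<odot>\<^bsub>plane R\<^esub> v"
      "t \<in> carrier R" "b = t \<odot>\<^bsub>plane R\<^esub> v" by (auto simp: span1_iff)
    then have "s \<otimes> r = t \<otimes> r"
      using eq h smult_inject[OF w, of "s \<otimes> r" "t \<otimes> r"] r by simp
    then show "a = b" using m_rcancel[of r s t] st r by simp
  qed
  moreover have "h ` span1 R v = span1 R w"
  proof
    show "h ` span1 R v \<subseteq> span1 R w"
      using h r smult_in_span1[of _ w] by (auto simp: span1_iff[of _ v] simp del: split_paired_All)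
    show "span1 R w \<subseteq> h ` span1 R v"
    proof
      fix b assume "b \<in> span1 R w"
      then obtain s where s: "s \<in> carrier R" "b = s \<odot>\<^bsub>plane R\<^esub> w" by (auto simp: span1_iff)
      then have "h ((s \<otimes> inv r) \<odot>\<^bsub>plane R\<^esub> v) = b"
        using h[of "s \<otimes> inv r"] i r by (simp add: m_assoc)
      moreover have "(s \<otimes> inv r) \<odot>\<^bsub>plane R\<^esub> v \<in> span1 R v"
        using s i by (auto simp: span1_iff)
      ultimately show "b \<in> h ` span1 R v" by blast
    qed
  qed
  moreover have "h (a \<oplus>\<^bsub>plane R\<^esub> b) = h a \<oplus>\<^bsub>plane R\<^esub> h b" if ab: "a \<in> span1 R v" "b \<in> span1 R v" for a b
  proof -
    obtain s t where st: "s \<in> carrier R" "a = s \<odot>\<^bsub>plane R\<^esub> v"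
      "t \<in> carrier R" "b = t \<odot>\<^bsub>plane R\<^esub> v" using ab by (auto simp: span1_iff)
    then have "a \<oplus>\<^bsub>plane R\<^esub> b = (s \<oplus> t) \<odot>\<^bsub>plane R\<^esub> v"
      using smult_l_distr[of v s t] v by simp
    then show ?thesis
      using h[of "s \<oplus> t"] h[of s] h[of t] smult_l_distr[of w "s \<otimes> r" "t \<otimes> r"] st r w
      by (simp add: l_distr)
  qed
  moreover have "h (t \<odot>\<^bsub>plane R\<^esub> a) = t \<odot>\<^bsub>plane R\<^esub> h a" if t: "t \<in> carrier R" and a: "a \<in> span1 R v" for t a
  proof -
    obtain s where s: "s \<in> carrier R" "a = s \<odot>\<^bsub>plane R\<^esub> v" using a by (auto simp: span1_iff)
    show ?thesis
      using h[OF s(1)] h[of "t \<otimes> s"] s t smult_smult[of v t s] smult_smult[of w t "s \<otimes> r"] v w r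
      by (simp add: m_assoc)
  qed
  moreover have "h \<in> extensional (span1 R v)" by (simp add: h_def scale_arrow_def)
  ultimately have "h \<in> linear_isos R (span1 R v) (span1 R w)"
    by (simp add: linear_isos_def bij_betw_def)
  moreover have "scale_arrow R v r w = (span1 R v, h, span1 R w)"
    by (simp add: h_def scale_arrow_def)
  moreover have "span1 R v \<in> lines R" "span1 R w \<in> lines R"
    using v w lines_iff by blast+
  ultimately show ?thesis by (simp add: Hom_def proj_line_def)
qed

lemma scale_arrow_cases:
  assumes v: "nonzero_vec v" and w: "nonzero_vec w"
    and f: "f \<in> Hom (proj_line R) (span1 R v) (span1 R w)"
  obtains r where "r \<in> carrier R" "r \<noteq> \<zero>" "f = scale_arrow R v r w"
proof -
  obtain h where f_eq: "f = (span1 R v, h, span1 R w)"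
    and h: "h \<in> linear_isos R (span1 R v) (span1 R w)"
    using f by (auto simp: Hom_def proj_line_def)
  have bij: "bij_betw h (span1 R v) (span1 R w)" and ext: "h \<in> extensional (span1 R v)"
    and hom: "\<And>s a. s \<in> carrier R \<Longrightarrow> a \<in> span1 R v \<Longrightarrow> h (s \<odot>\<^bsub>plane R\<^esub> a) = s \<odot>\<^bsub>plane R\<^esub> h a"
    using h by (auto simp: linear_isos_def)
  have vv: "v \<in> span1 R v" using span1_self v by simp
  then have "h v \<in> span1 R w" using bij_betwE[OF bij] by blast
  then obtain r where r: "r \<in> carrier R" "h v = r \<odot>\<^bsub>plane R\<^esub> w"
    by (auto simp: span1_iff)
  have val: "h (s \<odot>\<^bsub>plane R\<^esub> v) = (s \<otimes> r) \<odot>\<^bsub>plane R\<^esub> w" if "s \<in> carrier R" for s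
    using hom[OF that vv] r smult_smult[of w s r] that w by simp
  have "r \<noteq> \<zero>"
  proof
    assume "r = \<zero>"
    then have "h v = h (\<zero> \<odot>\<^bsub>plane R\<^esub> v)"
      using r(2) val[of \<zero>] by simp
    moreover have "\<zero> \<odot>\<^bsub>plane R\<^esub> v \<in> span1 R v" by (auto simp: span1_iff)
    ultimately have "v = \<zero> \<odot>\<^bsub>plane R\<^esub> v"
      using bij vv by (auto dest: inj_onD simp: bij_betw_def)
    moreover have "\<zero> \<odot>\<^bsub>plane R\<^esub> v = \<zero>\<^bsub>plane R\<^esub>" using v by (auto simp: plane_simps)
    ultimately show False using v by simp
  qed
  then show thesis
    using that[OF r(1)] scale_arrow_eqI[OF v r(1) ext val] f_eq by simp
qed

lemma scale_arrow_comp: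
  assumes v: "nonzero_vec v" and w: "nonzero_vec w" and r: "r \<in> carrier R" and s: "s \<in> carrier R"
  shows "comp (proj_line R) (scale_arrow R v r w) (scale_arrow R w s u) = scale_arrow R v (r \<otimes> s) u"
proof -
  define h where "h = fst (snd (scale_arrow R v r w))"
  define k where "k = fst (snd (scale_arrow R w s u))"
  have "(span1 R v, compose (span1 R v) k h, span1 R u) = scale_arrow R v (r \<otimes> s) u"
  proof (rule scale_arrow_eqI[OF v])
    fix t assume t: "t \<in> carrier R"
    then have "t \<odot>\<^bsub>plane R\<^esub> v \<in> span1 R v" by (auto simp: span1_iff)
    then have "compose (span1 R v) k h (t \<odot>\<^bsub>plane R\<^esub> v) = k (h (t \<odot>\<^bsub>plane R\<^esub> v))"
      by (simp add: compose_def)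
    also have "\<dots> = ((t \<otimes> r) \<otimes> s) \<odot>\<^bsub>plane R\<^esub> u"
      using scale_arrow_apply[OF v t] scale_arrow_apply[OF w, of "t \<otimes> r"] t r
      by (simp add: h_def k_def)
    finally show "compose (span1 R v) k h (t \<odot>\<^bsub>plane R\<^esub> v) = (t \<otimes> (r \<otimes> s)) \<odot>\<^bsub>plane R\<^esub> u"
      using t r s by (simp add: m_assoc)
  qed (use r s in auto)
  then show ?thesis
    by (simp add: h_def k_def scale_arrow_def proj_line_def)
qed

lemma homothety_eq_scale_arrow:
  assumes v: "nonzero_vec v" and r: "r \<in> carrier R"
  shows "homothety R r (span1 R v) = scale_arrow R v r v"
  unfolding homothety_def
proof (rule scale_arrow_eqI[OF v r])
  fix s assume s: "s \<in> carrier R"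
  then have "s \<odot>\<^bsub>plane R\<^esub> v \<in> span1 R v" by (auto simp: span1_iff)
  then show "(\<lambda>a\<in>span1 R v. r \<odot>\<^bsub>plane R\<^esub> a) (s \<odot>\<^bsub>plane R\<^esub> v) = (s \<otimes> r) \<odot>\<^bsub>plane R\<^esub> v"
    using smult_smult[of v r s] v r s by (simp add: m_comm)
qed auto

lemma idn_eq_scale_arrow:
  assumes v: "nonzero_vec v"
  shows "idn (proj_line R) (span1 R v) = scale_arrow R v \<one> v"
proof -
  have "(span1 R v, (\<lambda>a\<in>span1 R v. a), span1 R v) = scale_arrow R v \<one> v"
    by (rule scale_arrow_eqI[OF v]) (auto simp: span1_iff)
  then show ?thesis by (simp add: proj_line_def)
qed

text \<open>The point \<open>s v - t w\<close> lies on the line of \<open>u\<close> iff \<open>s det(v, u) = t det(w, u)\<close>. Hence the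
  projection along \<open>u\<close> sends \<open>v\<close> to \<open>r w\<close>, where \<open>r\<close> is the quotient of these determinants.\<close>

lemma prj_eq_scale_arrow:
  assumes v: "nonzero_vec v" and w: "nonzero_vec w" and u: "nonzero_vec u"
    and r: "r \<in> carrier R" "r \<otimes> det2 R w u = det2 R v u" and wu: "det2 R w u \<noteq> \<zero>"
  shows "prj (proj_line R) (span1 R v) (span1 R u) (span1 R w) = scale_arrow R v r w"
proof -
  let ?p = "\<lambda>a\<in>span1 R v. THE b. b \<in> span1 R w \<and> a \<ominus>\<^bsub>plane R\<^esub> b \<in> span1 R u"
  have "(span1 R v, ?p, span1 R w) = scale_arrow R v r w"
  proof (rule scale_arrow_eqI[OF v r(1)])
    fix s assume s: "s \<in> carrier R"
    have cl: "det2 R v u \<in> carrier R" "det2 R w u \<in> carrier R"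
      using det2_in_carrier v w u by auto
    have sv: "s \<odot>\<^bsub>plane R\<^esub> v \<in> span1 R v" "s \<odot>\<^bsub>plane R\<^esub> v \<in> carrier (plane R)"
      using smult_in_span1[OF s, of v] span1_subset[of v] v by blast+
    have iff: "s \<odot>\<^bsub>plane R\<^esub> v \<ominus>\<^bsub>plane R\<^esub> t \<odot>\<^bsub>plane R\<^esub> w \<in> span1 R u \<longleftrightarrow> t = s \<otimes> r"
      if t: "t \<in> carrier R" for t
    proof -
      have tw: "t \<odot>\<^bsub>plane R\<^esub> w \<in> carrier (plane R)"
        using t w by (auto simp: plane_simps)
      have "s \<odot>\<^bsub>plane R\<^esub> v \<ominus>\<^bsub>plane R\<^esub> t \<odot>\<^bsub>plane R\<^esub> w \<in> carrier (plane R)"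
        using sv(2) tw by (simp only: plane_minus) (auto simp: plane_simps)
      then have "s \<odot>\<^bsub>plane R\<^esub> v \<ominus>\<^bsub>plane R\<^esub> t \<odot>\<^bsub>plane R\<^esub> w \<in> span1 R u
          \<longleftrightarrow> s \<otimes> det2 R v u \<ominus> t \<otimes> det2 R w u = \<zero>"
        using mem_span1_iff_det2[OF u] det2_minus[OF sv(2) tw] det2_smult v w u s t by simp
      also have "\<dots> \<longleftrightarrow> s \<otimes> det2 R v u = t \<otimes> det2 R w u"
        using s t cl by simp
      also have "\<dots> \<longleftrightarrow> (s \<otimes> r) \<otimes> det2 R w u = t \<otimes> det2 R w u"
        using r s cl by (simp add: m_assoc)
      also have "\<dots> \<longleftrightarrow> s \<otimes> r = t"
        using m_rcancel[OF wu] cl s t r by simp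
      finally show ?thesis by auto
    qed
    have "(THE b. b \<in> span1 R w \<and> s \<odot>\<^bsub>plane R\<^esub> v \<ominus>\<^bsub>plane R\<^esub> b \<in> span1 R u) = (s \<otimes> r) \<odot>\<^bsub>plane R\<^esub> w"
    proof (rule the_equality)
      show "(s \<otimes> r) \<odot>\<^bsub>plane R\<^esub> w \<in> span1 R w \<and>
          s \<odot>\<^bsub>plane R\<^esub> v \<ominus>\<^bsub>plane R\<^esub> (s \<otimes> r) \<odot>\<^bsub>plane R\<^esub> w \<in> span1 R u"
        using iff[of "s \<otimes> r"] smult_in_span1[of "s \<otimes> r" w] s r(1) by simp
    next
      fix b assume b: "b \<in> span1 R w \<and> s \<odot>\<^bsub>plane R\<^esub> v \<ominus>\<^bsub>plane R\<^esub> b \<in> span1 R u"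
      then obtain t where "t \<in> carrier R" "b = t \<odot>\<^bsub>plane R\<^esub> w" by (auto simp: span1_iff[of _ w])
      then show "b = (s \<otimes> r) \<odot>\<^bsub>plane R\<^esub> w" using iff[of t] b by simp
    qed
    then show "?p (s \<odot>\<^bsub>plane R\<^esub> v) = (s \<otimes> r) \<odot>\<^bsub>plane R\<^esub> w"
      using sv(1) by simp
  qed auto
  then show ?thesis by (simp add: proj_line_def)
qed

end

section \<open>Coordinates from normalised weights\<close>

context projective_line_candidate
begin

lemma prj_in_Hom:
  assumes "{A, B, C} \<subseteq> Obj L" "distinct [A, B, C]"
  shows "prj L A C B \<in> Hom L A B"
  using bij_betwE[OF labelling[of A B]] assms by auto

lemma prj_cases:
  assumes "f \<in> Hom L A B" "A \<noteq> B"
  obtains C where "C \<in> Obj L" "distinct [A, B, C]" "f = prj L A C B"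
proof -
  have "f \<in> (\<lambda>C. prj L A C B) ` (Obj L - {A, B})"
    using bij_betw_imp_surj_on[OF labelling[of A B]] assms Hom_objects[OF assms(1)] by simp
  then show thesis using that assms(2) by auto
qed

lemma prj_inject:
  assumes "{A, B, C, D} \<subseteq> Obj L" "distinct [A, B, C]" "distinct [A, B, D]"
    and "prj L A C B = prj L A D B"
  shows "C = D"
  using inj_onD[OF bij_betw_imp_inj_on[OF labelling[of A B]] assms(4)] assms(1-3) by auto

end

text \<open>What remains of a frame once scalars at the base object are read as nonzero elements of \<open>K\<close>.\<close>

locale weighted_line = projective_line_candidate L + K: field K for L (structure) and K +
  fixes wt
  assumes wt_bij: "A \<in> Obj L \<Longrightarrow> B \<in> Obj L \<Longrightarrow>
           bij_betw wt (Hom L A B) (carrier K - {\<zero>\<^bsub>K\<^esub>})"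
    and wt_comp: "f \<in> Hom L A B \<Longrightarrow> g \<in> Hom L B C \<Longrightarrow> wt (f \<cdot> g) = wt f \<otimes>\<^bsub>K\<^esub> wt g"
begin

lemma wt_closed:
  assumes "f \<in> Hom L A B"
  shows "wt f \<in> carrier K" "wt f \<noteq> \<zero>\<^bsub>K\<^esub>"
  using bij_betwE[OF wt_bij[OF Hom_objects[OF assms]]] assms by auto

lemma wt_inject:
  assumes "f \<in> Hom L A B" "g \<in> Hom L A B" "wt f = wt g"
  shows "f = g"
  using inj_onD[OF bij_betw_imp_inj_on[OF wt_bij[OF Hom_objects[OF assms(1)]]] assms(3,1,2)] .

lemma wt_idn:
  assumes A: "A \<in> Obj L"
  shows "wt (idn L A) = \<one>\<^bsub>K\<^esub>"
proof -
  note i = idn_closed[OF A]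
  have "wt (idn L A) \<otimes>\<^bsub>K\<^esub> wt (idn L A) = wt (idn L A) \<otimes>\<^bsub>K\<^esub> \<one>\<^bsub>K\<^esub>"
    using wt_comp[OF i i] idn_left[OF i] wt_closed[OF i] by simp
  then show ?thesis
    using K.m_lcancel[of "wt (idn L A)" "wt (idn L A)" "\<one>\<^bsub>K\<^esub>"] wt_closed[OF i] by simp
qed

end

text \<open>The condition \<open>wt_add\<close> is \<open>\<Phi>(x) = 1 - x\<close>, moved to an arbitrary vertex. The last two conditions
  fix the frame. In the target, with the spanning vectors \<open>(0, 1)\<close> for \<open>X\<close>, \<open>(1, 0)\<close> for \<open>Y\<close> and
  \<open>(1, m)\<close> for any other line, the projection along \<open>X\<close> sends \<open>(1, 0)\<close> to \<open>(1, m)\<close>, and the one along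
  \<open>Z = [1:1]\<close> sends \<open>(1, 0)\<close> to \<open>-(0, 1)\<close>: these are the weights \<open>1\<close> and \<open>-1\<close>.\<close>

locale normalised_line = abstract_projective_line L + weighted_line L K wt
  for L (structure) and K and wt +
  fixes X Y Z
  assumes XYZ: "{X, Y, Z} \<subseteq> Obj L" "distinct [X, Y, Z]"
    and wt_add: "{A, B, C, D} \<subseteq> Obj L \<Longrightarrow> distinct [A, B, C, D] \<Longrightarrow>
      wt (cross_ratio L A B C D) \<oplus>\<^bsub>K\<^esub> wt (cross_ratio L A C B D) = \<one>\<^bsub>K\<^esub>"
    and wt_Y_X: "D \<in> Obj L \<Longrightarrow> distinct [X, Y, D] \<Longrightarrow> wt (prj L Y X D) = \<one>\<^bsub>K\<^esub>"
    and wt_Y_Z_X: "wt (prj L Y Z X) = \<ominus>\<^bsub>K\<^esub> \<one>\<^bsub>K\<^esub>"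
begin

lemma XYZ_simps [simp]:
  "X \<in> Obj L" "Y \<in> Obj L" "Z \<in> Obj L"
  "X \<noteq> Y" "Y \<noteq> X" "X \<noteq> Z" "Z \<noteq> X" "Y \<noteq> Z" "Z \<noteq> Y"
  using XYZ by auto

abbreviation coef where "coef A C B \<equiv> wt (prj L A C B)"

text \<open>In the target, the projection along the line of \<open>(1, m)\<close> sends \<open>(1, 0)\<close> to \<open>-m (0, 1)\<close>; this
  forces the choice of the slope. It equals the cross ratio \<open>(X, Y; Z, D)\<close>.\<close>

definition slope where "slope D = \<ominus>\<^bsub>K\<^esub> coef Y D X"

definition vec where
  "vec D = (if D = X then (\<zero>\<^bsub>K\<^esub>, \<one>\<^bsub>K\<^esub>) else if D = Y then (\<one>\<^bsub>K\<^esub>, \<zero>\<^bsub>K\<^esub>) else (\<one>\<^bsub>K\<^esub>, slope D))"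

text \<open>The weight of \<open>A \<rightarrow> B\<close> with label \<open>C\<close> has the value that it has in \<open>P(K\<^sup>2)\<close> for the vectors
  \<open>vec\<close>, written without division.\<close>

definition coef_by_det where
  "coef_by_det A C B \<longleftrightarrow> coef A C B \<otimes>\<^bsub>K\<^esub> det2 K (vec B) (vec C) = det2 K (vec A) (vec C)"

lemma coef_closed:
  assumes "{A, B, C} \<subseteq> Obj L" "distinct [A, B, C]"
  shows "coef A C B \<in> carrier K" "coef A C B \<noteq> \<zero>\<^bsub>K\<^esub>"
  using wt_closed[OF prj_in_Hom[OF assms]] .

lemma coef_Inv:
  assumes "{A, B, C} \<subseteq> Obj L" "distinct [A, B, C]"
  shows "coef A C B \<otimes>\<^bsub>K\<^esub> coef B C A = \<one>\<^bsub>K\<^esub>"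
  using wt_comp[OF prj_in_Hom[of A B C] prj_in_Hom[of B A C]] Inv[OF assms] wt_idn[of A] assms
  by auto

lemma coef_Comp:
  assumes "{A, B, C, D} \<subseteq> Obj L" "distinct [A, B, C, D]"
  shows "coef A C B \<otimes>\<^bsub>K\<^esub> coef B C D = coef A C D"
  using wt_comp[OF prj_in_Hom[of A B C] prj_in_Hom[of B D C]] Comp[OF assms] assms
  by auto

lemma coef_add:
  assumes "{A, B, C, D} \<subseteq> Obj L" "distinct [A, B, C, D]"
  shows "coef A C B \<otimes>\<^bsub>K\<^esub> coef B D A \<oplus>\<^bsub>K\<^esub> coef A B C \<otimes>\<^bsub>K\<^esub> coef C D A = \<one>\<^bsub>K\<^esub>"
  using wt_add[OF assms] assms
    wt_comp[OF prj_in_Hom[of A B C] prj_in_Hom[of B A D]]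
    wt_comp[OF prj_in_Hom[of A C B] prj_in_Hom[of C A D]]
  unfolding cross_ratio_def by auto

lemma slope_closed:
  assumes "D \<in> Obj L" "distinct [X, Y, D]"
  shows "slope D \<in> carrier K" "slope D \<noteq> \<zero>\<^bsub>K\<^esub>"
  using assms XYZ coef_closed[of Y X D] K.minus_minus[of "coef Y D X"]
  by (auto simp: slope_def)

lemma vec_closed:
  assumes "D \<in> Obj L"
  shows "fst (vec D) \<in> carrier K" "snd (vec D) \<in> carrier K"
  using slope_closed[OF assms] by (auto simp: vec_def)

lemma det2_closed:
  assumes "A \<in> Obj L" "B \<in> Obj L"
  shows "det2 K (vec A) (vec B) \<in> carrier K"
  using vec_closed[OF assms(1)] vec_closed[OF assms(2)] by (simp add: det2_def)

lemma vec_X: "vec X = (\<zero>\<^bsub>K\<^esub>, \<one>\<^bsub>K\<^esub>)"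
  and vec_Y: "vec Y = (\<one>\<^bsub>K\<^esub>, \<zero>\<^bsub>K\<^esub>)"
  and vec_other: "distinct [X, Y, D] \<Longrightarrow> vec D = (\<one>\<^bsub>K\<^esub>, slope D)"
  using XYZ by (auto simp: vec_def)

lemma vec_Z: "vec Z = (\<one>\<^bsub>K\<^esub>, \<one>\<^bsub>K\<^esub>)"
  using XYZ by (simp add: vec_other slope_def wt_Y_Z_X)

lemma coef_by_det_sym:
  assumes o: "{A, B, C} \<subseteq> Obj L" and d: "distinct [A, B, C]" and "coef_by_det A C B"
  shows "coef_by_det B C A"
proof -
  have c: "coef A C B \<in> carrier K" "coef B C A \<in> carrier K"
    using o d by (auto intro!: coef_closed)
  have i: "coef B C A \<otimes>\<^bsub>K\<^esub> coef A C B = \<one>\<^bsub>K\<^esub>"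
    using coef_Inv[of B A C] o d by auto
  have dc: "det2 K (vec B) (vec C) \<in> carrier K" using o by (simp add: det2_closed)
  have "coef B C A \<otimes>\<^bsub>K\<^esub> det2 K (vec A) (vec C)
      = (coef B C A \<otimes>\<^bsub>K\<^esub> coef A C B) \<otimes>\<^bsub>K\<^esub> det2 K (vec B) (vec C)"
    using assms(3) c dc by (simp add: coef_by_det_def K.m_assoc)
  then show ?thesis using i dc by (simp add: coef_by_det_def)
qed

lemma coef_by_det_trans:
  assumes o: "{A, B, C, D} \<subseteq> Obj L" and d: "distinct [A, B, C, D]"
    and AB: "coef_by_det A C B" and BD: "coef_by_det B C D"
  shows "coef_by_det A C D"
proof -
  have c: "coef A C B \<in> carrier K" "coef B C D \<in> carrier K"
    using o d by (auto intro!: coef_closed)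
  have dc: "det2 K (vec D) (vec C) \<in> carrier K" using o by (simp add: det2_closed)
  have "coef A C D \<otimes>\<^bsub>K\<^esub> det2 K (vec D) (vec C)
      = coef A C B \<otimes>\<^bsub>K\<^esub> (coef B C D \<otimes>\<^bsub>K\<^esub> det2 K (vec D) (vec C))"
    using coef_Comp[OF o d, symmetric] c dc by (simp add: K.m_assoc)
  also have "\<dots> = det2 K (vec A) (vec C)"
    using AB BD by (simp add: coef_by_det_def)
  finally show ?thesis by (simp add: coef_by_det_def)
qed

text \<open>By \<open>Inv\<close> and \<open>Comp\<close>, the arrows with a fixed label \<open>C\<close> compose to arrows with label \<open>C\<close>, and
  their weights multiply in the same way as the quotients of determinants. Hence it suffices to
  compare the two on the arrows that start at one object \<open>P\<close>.\<close>

lemma coef_by_det_pivot: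
  assumes P: "P \<in> Obj L" "C \<in> Obj L" "P \<noteq> C"
    and pivot: "\<And>B. B \<in> Obj L \<Longrightarrow> distinct [P, B, C] \<Longrightarrow> coef_by_det P C B"
    and o: "{A, B} \<subseteq> Obj L" and d: "distinct [A, B, C]"
  shows "coef_by_det A C B"
proof -
  consider "A = P" | "B = P" | "distinct [A, P, B]" using d by auto
  then show ?thesis
  proof cases
    case 1
    then show ?thesis using pivot[of B] o d by auto
  next
    case 2
    then show ?thesis using coef_by_det_sym[of P A C] pivot[of A] o d P by auto
  next
    case 3
    then have "coef_by_det A C P"
      using coef_by_det_sym[of P A C] pivot[of A] o d P by auto
    then show ?thesis
      using coef_by_det_trans[of A P C B] pivot[of B] o d P 3 by auto
  qed
qed

lemma coef_by_det_label_X: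
  assumes "{A, B} \<subseteq> Obj L" "distinct [A, B, X]"
  shows "coef_by_det A X B"
proof (rule coef_by_det_pivot[where P = Y])
  fix B assume "B \<in> Obj L" "distinct [Y, B, X]"
  then have B: "B \<in> Obj L" "distinct [X, Y, B]" by auto
  then show "coef_by_det Y X B"
    using slope_closed[OF B] wt_Y_X[OF B]
    by (simp add: coef_by_det_def vec_X vec_Y vec_other det2_def K.minus_eq)
qed (use assms XYZ in auto)

lemma slope_inverse:
  assumes "D \<in> Obj L" "distinct [X, Y, D]"
  shows "coef X D Y \<otimes>\<^bsub>K\<^esub> slope D = \<ominus>\<^bsub>K\<^esub> \<one>\<^bsub>K\<^esub>"
  using assms coef_Inv[of X Y D] coef_closed[of X Y D] coef_closed[of Y X D] XYZ
  by (simp add: slope_def K.r_minus)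

text \<open>This is the relation \<open>1 = (Y, X; E, D) + (Y, E; X, D)\<close> multiplied by the slope of \<open>D\<close>: the first
  cross ratio is the quotient of the slopes of \<open>E\<close> and \<open>D\<close>, and the second reduces to the weight
  of \<open>E \<rightarrow> Y\<close> because the weight of \<open>Y \<rightarrow> E\<close> with label \<open>X\<close> is \<open>1\<close>.\<close>

lemma coef_to_Y:
  assumes o: "{D, E} \<subseteq> Obj L" and d: "distinct [X, Y, D, E]"
  shows "coef E D Y \<otimes>\<^bsub>K\<^esub> slope D = slope D \<ominus>\<^bsub>K\<^esub> slope E"
proof -
  have cl: "coef E D Y \<in> carrier K" "coef X D Y \<in> carrier K" "coef Y E X \<in> carrier K"
    "slope D \<in> carrier K" "slope E \<in> carrier K"
    using o d XYZ by (auto intro!: coef_closed slope_closed)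
  have "coef Y E X \<otimes>\<^bsub>K\<^esub> coef X D Y \<oplus>\<^bsub>K\<^esub> coef E D Y = \<one>\<^bsub>K\<^esub>"
    using coef_add[of Y X E D] wt_Y_X[of E] o d XYZ cl by auto
  then have "slope D = (coef Y E X \<otimes>\<^bsub>K\<^esub> coef X D Y \<oplus>\<^bsub>K\<^esub> coef E D Y) \<otimes>\<^bsub>K\<^esub> slope D"
    using cl by simp
  also have "\<dots> = coef Y E X \<otimes>\<^bsub>K\<^esub> (coef X D Y \<otimes>\<^bsub>K\<^esub> slope D) \<oplus>\<^bsub>K\<^esub> coef E D Y \<otimes>\<^bsub>K\<^esub> slope D"
    using cl by (simp add: K.l_distr K.m_assoc)
  also have "\<dots> = slope E \<oplus>\<^bsub>K\<^esub> coef E D Y \<otimes>\<^bsub>K\<^esub> slope D"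
    using slope_inverse[of D] o d cl by (simp add: slope_def K.r_minus)
  finally have "slope D \<ominus>\<^bsub>K\<^esub> slope E = (slope E \<oplus>\<^bsub>K\<^esub> coef E D Y \<otimes>\<^bsub>K\<^esub> slope D) \<ominus>\<^bsub>K\<^esub> slope E"
    by simp
  also have "\<dots> = coef E D Y \<otimes>\<^bsub>K\<^esub> slope D"
    using cl by algebra
  finally show ?thesis by simp
qed

lemma coef_by_det_label_other:
  assumes D: "D \<in> Obj L" "distinct [X, Y, D]" and "{A, B} \<subseteq> Obj L" "distinct [A, B, D]"
  shows "coef_by_det A D B"
proof (rule coef_by_det_pivot[where P = Y])
  fix B assume B: "B \<in> Obj L" "distinct [Y, B, D]"
  show "coef_by_det Y D B"
  proof (cases "B = X")
    case True
    then show ?thesis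
      using D slope_closed[of D] coef_closed[of Y X D] XYZ
      by (simp add: coef_by_det_def vec_X vec_Y vec_other det2_def slope_def K.minus_eq K.r_minus)
  next
    case False
    then have dist: "distinct [X, Y, D, B]" "distinct [X, Y, B]" using B D by auto
    then have "coef_by_det B D Y"
      using coef_to_Y[of D B] B(1) D slope_closed[of B] slope_closed[of D]
      by (simp add: coef_by_det_def vec_Y vec_other det2_def K.minus_eq)
    then show ?thesis using coef_by_det_sym[of B Y D] B D XYZ by auto
  qed
qed (use assms XYZ in auto)

lemma slope_surj:
  assumes "r \<in> carrier K" "r \<noteq> \<zero>\<^bsub>K\<^esub>"
  obtains D where "D \<in> Obj L" "distinct [X, Y, D]" "slope D = r"
proof -
  have "\<ominus>\<^bsub>K\<^esub> r \<in> carrier K - {\<zero>\<^bsub>K\<^esub>}"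
    using assms K.minus_minus[of r] by auto
  also have "carrier K - {\<zero>\<^bsub>K\<^esub>} = wt ` Hom L Y X"
    using wt_bij[of Y X] by (simp add: bij_betw_def)
  finally obtain f where f: "f \<in> Hom L Y X" "wt f = \<ominus>\<^bsub>K\<^esub> r"
    by (metis imageE)
  obtain D where "D \<in> Obj L" "distinct [Y, X, D]" "f = prj L Y D X"
    using prj_cases[OF f(1)] XYZ by auto
  then show thesis using that[of D] f(2) assms(1) by (auto simp: slope_def)
qed

lemma slope_inject:
  assumes "{D, E} \<subseteq> Obj L" "distinct [X, Y, D]" "distinct [X, Y, E]" "slope D = slope E"
  shows "D = E"
proof -
  have h: "prj L Y D X \<in> Hom L Y X" "prj L Y E X \<in> Hom L Y X"
    using assms XYZ by (auto intro!: prj_in_Hom)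
  have "coef Y D X = coef Y E X"
    using assms(4) wt_closed(1)[OF h(1)] wt_closed(1)[OF h(2)] K.a_inv_inj
    by (auto simp: slope_def dest: inj_onD)
  then show ?thesis
    using wt_inject[OF h] prj_inject[of Y X D E] assms XYZ by auto
qed

lemma slope_diff_nonzero:
  assumes "{D, E} \<subseteq> Obj L" "distinct [X, Y, D]" "distinct [X, Y, E]" "D \<noteq> E"
  shows "slope E \<ominus>\<^bsub>K\<^esub> slope D \<noteq> \<zero>\<^bsub>K\<^esub>"
  using assms slope_closed[of D] slope_closed[of E] slope_inject[of D E] by auto

text \<open>In the relation \<open>1 = (X, E; Y, D) + (X, Y; E, D)\<close> the weight of \<open>X \<rightarrow> E\<close> with label \<open>Y\<close> is the only
  unknown, and its coefficient \<open>slope E - slope D\<close> is not zero. This requires a fourth object \<open>D\<close>.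
  If there is none, then \<open>slope E\<close> is the only nonzero element of \<open>K\<close>.\<close>

lemma coef_Y_to_X:
  assumes E: "E \<in> Obj L" "distinct [X, Y, E]"
  shows "coef E Y X = slope E"
proof (cases "\<exists>D \<in> Obj L. distinct [X, Y, D, E]")
  case True
  then obtain D where D: "D \<in> Obj L" "distinct [X, Y, D, E]" by blast
  have cl: "coef X E Y \<in> carrier K" "coef Y D X \<in> carrier K" "coef E Y X \<in> carrier K"
    "coef X Y E \<in> carrier K" "coef E D X \<in> carrier K" "slope D \<in> carrier K" "slope E \<in> carrier K"
    using D E XYZ by (auto intro!: coef_closed slope_closed)
  define \<delta> where "\<delta> = slope E \<ominus>\<^bsub>K\<^esub> slope D"
  have \<delta>: "\<delta> \<in> carrier K" "\<delta> \<noteq> \<zero>\<^bsub>K\<^esub>"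
    using cl slope_diff_nonzero[of D E] D E by (auto simp: \<delta>_def)
  have "coef E D X \<otimes>\<^bsub>K\<^esub> \<ominus>\<^bsub>K\<^esub> \<one>\<^bsub>K\<^esub> = slope D \<ominus>\<^bsub>K\<^esub> slope E"
    using coef_by_det_label_other[of D E X] D E cl
    by (simp add: eq_commute[of D E] eq_commute[of X E] coef_by_det_def vec_X vec_other det2_def K.minus_eq)
  then have "\<ominus>\<^bsub>K\<^esub> (coef E D X \<otimes>\<^bsub>K\<^esub> \<ominus>\<^bsub>K\<^esub> \<one>\<^bsub>K\<^esub>) = \<ominus>\<^bsub>K\<^esub> (slope D \<ominus>\<^bsub>K\<^esub> slope E)"
    by simp
  moreover have "\<ominus>\<^bsub>K\<^esub> (coef E D X \<otimes>\<^bsub>K\<^esub> \<ominus>\<^bsub>K\<^esub> \<one>\<^bsub>K\<^esub>) = coef E D X"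
    using cl by algebra
  moreover have "\<ominus>\<^bsub>K\<^esub> (slope D \<ominus>\<^bsub>K\<^esub> slope E) = \<delta>"
    unfolding \<delta>_def using cl by algebra
  ultimately have coef_E_D_X: "coef E D X = \<delta>" by simp
  have "coef X Y E \<otimes>\<^bsub>K\<^esub> \<delta> \<oplus>\<^bsub>K\<^esub> coef X E Y \<otimes>\<^bsub>K\<^esub> coef Y D X = \<one>\<^bsub>K\<^esub>"
    using coef_add[of X E Y D] coef_E_D_X D E by auto
  then have "slope E = (coef X Y E \<otimes>\<^bsub>K\<^esub> \<delta> \<oplus>\<^bsub>K\<^esub> coef X E Y \<otimes>\<^bsub>K\<^esub> coef Y D X) \<otimes>\<^bsub>K\<^esub> slope E"
    using cl by simp
  also have "\<dots> = coef X Y E \<otimes>\<^bsub>K\<^esub> \<delta> \<otimes>\<^bsub>K\<^esub> slope E \<oplus>\<^bsub>K\<^esub> (coef X E Y \<otimes>\<^bsub>K\<^esub> slope E) \<otimes>\<^bsub>K\<^esub> coef Y D X"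
    using cl \<delta>(1) by algebra
  also have "\<dots> = coef X Y E \<otimes>\<^bsub>K\<^esub> \<delta> \<otimes>\<^bsub>K\<^esub> slope E \<oplus>\<^bsub>K\<^esub> slope D"
    using slope_inverse[OF E] cl by (simp add: slope_def K.l_minus)
  finally have "\<delta> = (coef X Y E \<otimes>\<^bsub>K\<^esub> \<delta> \<otimes>\<^bsub>K\<^esub> slope E \<oplus>\<^bsub>K\<^esub> slope D) \<ominus>\<^bsub>K\<^esub> slope D"
    by (simp add: \<delta>_def)
  also have "\<dots> = coef X Y E \<otimes>\<^bsub>K\<^esub> \<delta> \<otimes>\<^bsub>K\<^esub> slope E"
    using cl \<delta>(1) by algebra
  finally have "\<delta> = coef X Y E \<otimes>\<^bsub>K\<^esub> \<delta> \<otimes>\<^bsub>K\<^esub> slope E" .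
  then have "coef E Y X \<otimes>\<^bsub>K\<^esub> \<delta> = coef E Y X \<otimes>\<^bsub>K\<^esub> (coef X Y E \<otimes>\<^bsub>K\<^esub> \<delta> \<otimes>\<^bsub>K\<^esub> slope E)"
    by (rule arg_cong)
  also have "\<dots> = (coef E Y X \<otimes>\<^bsub>K\<^esub> coef X Y E) \<otimes>\<^bsub>K\<^esub> (slope E \<otimes>\<^bsub>K\<^esub> \<delta>)"
    using cl \<delta> by algebra
  also have "\<dots> = slope E \<otimes>\<^bsub>K\<^esub> \<delta>"
    using coef_Inv[of E X Y] E XYZ cl \<delta> by auto
  finally show ?thesis
    using K.m_rcancel[OF \<delta>(2,1)] cl by simp
next
  case False
  then have "\<And>D. D \<in> Obj L \<Longrightarrow> distinct [X, Y, D] \<Longrightarrow> D = E"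
    using E by auto
  moreover obtain D where "D \<in> Obj L" "distinct [X, Y, D]" "slope D = coef E Y X"
    using slope_surj[of "coef E Y X"] coef_closed[of E X Y] E by auto
  ultimately show ?thesis by metis
qed

lemma coef_by_det_label_Y:
  assumes "{A, B} \<subseteq> Obj L" "distinct [A, B, Y]"
  shows "coef_by_det A Y B"
proof (rule coef_by_det_pivot[where P = X])
  fix B assume B: "B \<in> Obj L" "distinct [X, B, Y]"
  then have dist: "distinct [X, Y, B]" by auto
  then have "coef_by_det B Y X"
    using coef_Y_to_X[OF B(1) dist] slope_closed[OF B(1) dist]
    by (simp add: coef_by_det_def vec_X vec_Y vec_other det2_def K.minus_eq K.r_minus)
  then show "coef_by_det X Y B"
    using coef_by_det_sym[of B X Y] B XYZ by auto
qed (use assms XYZ in auto)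

theorem coef_det:
  assumes o: "{A, B, C} \<subseteq> Obj L" and d: "distinct [A, B, C]"
  shows "coef A C B \<otimes>\<^bsub>K\<^esub> det2 K (vec B) (vec C) = det2 K (vec A) (vec C)"
proof -
  have "coef_by_det A C B"
  proof (cases "C = X \<or> C = Y")
    case True
    then show ?thesis
      using coef_by_det_label_X[of A B] coef_by_det_label_Y[of A B] o d by auto
  next
    case False
    then show ?thesis
      using coef_by_det_label_other[of C A B] o d by auto
  qed
  then show ?thesis by (simp add: coef_by_det_def)
qed

lemma det2_nonzero:
  assumes "{A, B} \<subseteq> Obj L" "A \<noteq> B"
  shows "det2 K (vec A) (vec B) \<noteq> \<zero>\<^bsub>K\<^esub>"
proof -
  have generic: "det2 K (vec D) (vec E) = slope E \<ominus>\<^bsub>K\<^esub> slope D"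
    if "{D, E} \<subseteq> Obj L" "distinct [X, Y, D]" "distinct [X, Y, E]" for D E
    using that slope_closed[of D] slope_closed[of E] by (simp add: vec_other det2_def K.minus_eq)
  have one_axis: "det2 K (vec D) (vec X) = \<one>\<^bsub>K\<^esub>" "det2 K (vec X) (vec D) = \<ominus>\<^bsub>K\<^esub> \<one>\<^bsub>K\<^esub>"
    "det2 K (vec D) (vec Y) = \<ominus>\<^bsub>K\<^esub> slope D" "det2 K (vec Y) (vec D) = slope D"
    if "D \<in> Obj L" "distinct [X, Y, D]" for D
    using slope_closed[OF that] by (simp_all add: vec_X vec_Y vec_other[OF that(2)] det2_def K.minus_eq)
  have axes: "det2 K (vec X) (vec Y) = \<ominus>\<^bsub>K\<^esub> \<one>\<^bsub>K\<^esub>" "det2 K (vec Y) (vec X) = \<one>\<^bsub>K\<^esub>"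
    by (simp_all add: vec_X vec_Y det2_def K.minus_eq)
  have neg: "\<ominus>\<^bsub>K\<^esub> r \<noteq> \<zero>\<^bsub>K\<^esub>" if "r \<in> carrier K" "r \<noteq> \<zero>\<^bsub>K\<^esub>" for r
    using that K.minus_minus[of r] by auto
  note neg1 = neg[OF K.one_closed K.one_not_zero]
  consider "A \<in> {X, Y}" "B \<in> {X, Y}" | "A \<in> {X, Y}" "distinct [X, Y, B]"
    | "distinct [X, Y, A]" "B \<in> {X, Y}" | "distinct [X, Y, A]" "distinct [X, Y, B]"
    by auto
  then show ?thesis
  proof cases
    case 1
    then have "A = X \<and> B = Y \<or> A = Y \<and> B = X" using assms(2) by auto
    then show ?thesis using axes neg1 K.one_not_zero by metis
  next
    case 2
    then have "A = X \<or> A = Y" "B \<in> Obj L" using assms(1) by auto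
    then show ?thesis
      using one_axis(2,4)[OF _ 2(2)] neg1 slope_closed(2)[OF _ 2(2)] by metis
  next
    case 3
    then have "B = X \<or> B = Y" "A \<in> Obj L" using assms(1) by auto
    then show ?thesis
      using one_axis(1,3)[OF _ 3(1)] neg[OF slope_closed[OF _ 3(1)]] K.one_not_zero by metis
  next
    case 4
    then show ?thesis using generic slope_diff_nonzero[of A B] assms by simp
  qed
qed

end

section \<open>Rigidity of isomorphisms\<close>

lemma Arr_iff_Hom: "f \<in> Arr L \<longleftrightarrow> f \<in> Hom L (src L f) (tgt L f)"
  by (simp add: Hom_def)

lemma plc_isoD:
  assumes "(F, G) \<in> plc_iso L M"
  shows "F \<in> extensional (Obj L)" "bij_betw F (Obj L) (Obj M)"
    "G \<in> extensional (Arr L)" "bij_betw G (Arr L) (Arr M)"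
    "\<And>f A B. f \<in> Hom L A B \<Longrightarrow> G f \<in> Hom M (F A) (F B)"
    "\<And>f g A B C. f \<in> Hom L A B \<Longrightarrow> g \<in> Hom L B C \<Longrightarrow> G (f \<cdot>\<^bsub>L\<^esub> g) = G f \<cdot>\<^bsub>M\<^esub> G g"
    "\<And>A B C. {A, B, C} \<subseteq> Obj L \<Longrightarrow> distinct [A, B, C] \<Longrightarrow>
       G (prj L A C B) = prj M (F A) (F C) (F B)"
proof -
  show "F \<in> extensional (Obj L)" "bij_betw F (Obj L) (Obj M)"
    "G \<in> extensional (Arr L)" and G: "bij_betw G (Arr L) (Arr M)"
    using assms by (simp_all add: plc_iso_def)
  show "G f \<in> Hom M (F A) (F B)" if "f \<in> Hom L A B" for f A B
    using assms that bij_betwE[OF G] by (simp add: plc_iso_def Hom_def)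
  show "G (f \<cdot>\<^bsub>L\<^esub> g) = G f \<cdot>\<^bsub>M\<^esub> G g" if "f \<in> Hom L A B" "g \<in> Hom L B C" for f g A B C
    using assms that by (simp add: plc_iso_def Hom_def)
  show "G (prj L A C B) = prj M (F A) (F C) (F B)"
    if "{A, B, C} \<subseteq> Obj L" "distinct [A, B, C]" for A B C
    using assms that unfolding plc_iso_def by blast
qed

context weighted_line
begin

text \<open>Conjugate scalars have equal weights, so an endomorphism that preserves the
  weights of the scalars at one object preserves those of all scalars. In particular it fixes
  the weight of \<open>(X, Y; Z, D)\<close>, and this scalar determines \<open>D\<close> once \<open>X, Y, Z\<close> are fixed. Labels then
  determine the arrows between different objects, and weights those from an object to itself.\<close>

lemma endo_trivial_if_weight_fixed:
  assumes \<phi>: "\<And>A. A \<in> Obj L \<Longrightarrow> \<phi> A \<in> Obj L" "inj_on \<phi> (Obj L)"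
    and \<gamma>: "\<And>f A B. f \<in> Hom L A B \<Longrightarrow> \<gamma> f \<in> Hom L (\<phi> A) (\<phi> B)"
    and \<gamma>_comp: "\<And>f g A B C. f \<in> Hom L A B \<Longrightarrow> g \<in> Hom L B C \<Longrightarrow> \<gamma> (f \<cdot> g) = \<gamma> f \<cdot> \<gamma> g"
    and \<gamma>_prj: "\<And>A B C. {A, B, C} \<subseteq> Obj L \<Longrightarrow> distinct [A, B, C] \<Longrightarrow>
      \<gamma> (prj L A C B) = prj L (\<phi> A) (\<phi> C) (\<phi> B)"
    and A0: "A0 \<in> Obj L" "\<And>\<mu>. \<mu> \<in> Hom L A0 A0 \<Longrightarrow> wt (\<gamma> \<mu>) = wt \<mu>"
    and XYZ: "{X, Y, Z} \<subseteq> Obj L" "distinct [X, Y, Z]" "\<phi> X = X" "\<phi> Y = Y" "\<phi> Z = Z"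
  shows "\<And>A. A \<in> Obj L \<Longrightarrow> \<phi> A = A" and "\<And>f. f \<in> Arr L \<Longrightarrow> \<gamma> f = f"
proof -
  have scalar: "wt (\<gamma> f) = wt f" if f: "f \<in> Hom L A A" for f A
  proof -
    have A: "A \<in> Obj L" using f Hom_objects by blast
    obtain g where g: "g \<in> Hom L A0 A" using transitive[OF A0(1) A] by blast
    have "wt f \<in> wt ` Hom L A0 A0"
      using wt_closed[OF f] bij_betw_imp_surj_on[OF wt_bij[OF A0(1) A0(1)]] by simp
    then obtain \<mu> where \<mu>: "\<mu> \<in> Hom L A0 A0" "wt \<mu> = wt f" by force
    note cl = wt_closed[OF f] wt_closed[OF g] wt_closed[OF \<gamma>[OF f]] wt_closed[OF \<gamma>[OF g]]
    \<comment> \<open>\<open>f\<close> is the conjugate by \<open>g\<close> of the scalar \<open>\<mu>\<close> at \<open>A0\<close>\<close>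
    have "g \<cdot> f = \<mu> \<cdot> g"
      using wt_inject[OF comp_closed[OF g f] comp_closed[OF \<mu>(1) g]]
        wt_comp[OF g f] wt_comp[OF \<mu>(1) g] \<mu>(2) cl by (simp add: K.m_comm)
    then have "\<gamma> g \<cdot> \<gamma> f = \<gamma> \<mu> \<cdot> \<gamma> g"
      using \<gamma>_comp[OF g f] \<gamma>_comp[OF \<mu>(1) g] by simp
    then have "wt (\<gamma> g) \<otimes>\<^bsub>K\<^esub> wt (\<gamma> f) = wt (\<gamma> \<mu>) \<otimes>\<^bsub>K\<^esub> wt (\<gamma> g)"
      using wt_comp[OF \<gamma>[OF g] \<gamma>[OF f]] wt_comp[OF \<gamma>[OF \<mu>(1)] \<gamma>[OF g]] by simp
    then have "wt (\<gamma> g) \<otimes>\<^bsub>K\<^esub> wt (\<gamma> f) = wt (\<gamma> g) \<otimes>\<^bsub>K\<^esub> wt f"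
      using A0(2)[OF \<mu>(1)] \<mu>(2) cl by (simp add: K.m_comm)
    then show ?thesis using K.m_lcancel[OF cl(8,7)] cl by simp
  qed
  show obj: "\<phi> D = D" if D: "D \<in> Obj L" for D
  proof (cases "D = X \<or> D = Y")
    case True
    then show ?thesis using XYZ by auto
  next
    case False
    have ne: "\<phi> D \<noteq> X" "\<phi> D \<noteq> Y"
      using inj_onD[OF \<phi>(2), of D X] inj_onD[OF \<phi>(2), of D Y] XYZ D False by auto
    have h: "prj L X Z Y \<in> Hom L X Y" "prj L Y D X \<in> Hom L Y X" "prj L Y (\<phi> D) X \<in> Hom L Y X"
      using XYZ D \<phi>(1)[OF D] False ne by (auto intro!: prj_in_Hom)
    note cl = wt_closed[OF h(1)] wt_closed[OF h(2)] wt_closed[OF h(3)]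
    have p: "\<gamma> (prj L X Z Y) = prj L X Z Y" "\<gamma> (prj L Y D X) = prj L Y (\<phi> D) X"
      using \<gamma>_prj[of X Y Z] \<gamma>_prj[of Y X D] XYZ D False by auto
    have "wt (prj L X Z Y \<cdot> prj L Y (\<phi> D) X) = wt (prj L X Z Y \<cdot> prj L Y D X)"
      using scalar[OF comp_closed[OF h(1,2)]] \<gamma>_comp[OF h(1,2)] p by simp
    then have "wt (prj L Y (\<phi> D) X) = wt (prj L Y D X)"
      using wt_comp[OF h(1,2)] wt_comp[OF h(1,3)] K.m_lcancel[OF cl(2,1)] cl by simp
    then show ?thesis
      using wt_inject[OF h(3,2)] prj_inject[of Y X "\<phi> D" D] XYZ D \<phi>(1)[OF D] False ne by auto
  qed
  show "\<gamma> f = f" if "f \<in> Arr L" for f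
  proof -
    obtain A B where f: "f \<in> Hom L A B" using \<open>f \<in> Arr L\<close> Arr_iff_Hom by metis
    note AB = Hom_objects[OF f]
    show ?thesis
    proof (cases "A = B")
      case True
      then show ?thesis
        using wt_inject[OF _ _ scalar] \<gamma>[OF f] f obj[OF AB(1)] by auto
    next
      case False
      obtain C where C: "C \<in> Obj L" "distinct [A, B, C]" "f = prj L A C B"
        using prj_cases[OF f False] .
      then show ?thesis using \<gamma>_prj[of A B C] AB obj by simp
    qed
  qed
qed

text \<open>Following one isomorphism by the inverse of the other gives an endomorphism of \<open>L\<close> to which the
  previous lemma applies. All computations then take place in \<open>L\<close>, where weights are available.\<close>

lemma plc_iso_unique:
  assumes FG: "(F, G) \<in> plc_iso L M" and FG': "(F', G') \<in> plc_iso L M"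
    and A0: "A0 \<in> Obj L"
    and scal: "\<And>\<mu> \<nu> A. \<mu> \<in> Hom L A0 A0 \<Longrightarrow> \<nu> \<in> Hom L A A \<Longrightarrow> G \<mu> = G' \<nu> \<Longrightarrow> wt \<mu> = wt \<nu>"
    and XYZ: "{X, Y, Z} \<subseteq> Obj L" "distinct [X, Y, Z]" "F X = F' X" "F Y = F' Y" "F Z = F' Z"
  shows "(F, G) = (F', G')"
proof -
  note i = plc_isoD[OF FG] and i' = plc_isoD[OF FG']
  define \<phi> where "\<phi> A = inv_into (Obj L) F' (F A)" for A
  define \<gamma> where "\<gamma> f = inv_into (Arr L) G' (G f)" for f
  have \<phi>: "\<phi> A \<in> Obj L" "F' (\<phi> A) = F A" if "A \<in> Obj L" for A
    using i(2) i'(2) that bij_betwE[OF i(2)]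
    by (auto simp: \<phi>_def bij_betw_def inv_into_into f_inv_into_f)
  have \<gamma>A: "\<gamma> f \<in> Arr L" "G' (\<gamma> f) = G f" if "f \<in> Arr L" for f
    using i(4) i'(4) that bij_betwE[OF i(4)]
    by (auto simp: \<gamma>_def bij_betw_def inv_into_into f_inv_into_f)
  have F'_inj: "A = B" if "A \<in> Obj L" "B \<in> Obj L" "F' A = F' B" for A B
    using inj_onD[OF bij_betw_imp_inj_on[OF i'(2)] that(3,1,2)] .
  have G'_inj: "f = g" if "f \<in> Arr L" "g \<in> Arr L" "G' f = G' g" for f g
    using inj_onD[OF bij_betw_imp_inj_on[OF i'(4)] that(3,1,2)] .
  have Arr: "f \<in> Arr L" if "f \<in> Hom L A B" for f A B using that by (simp add: Hom_def)
  have \<gamma>: "\<gamma> f \<in> Hom L (\<phi> A) (\<phi> B)" if f: "f \<in> Hom L A B" for f A B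
  proof -
    note AB = Hom_objects[OF f]
    have h: "\<gamma> f \<in> Hom L (src L (\<gamma> f)) (tgt L (\<gamma> f))"
      using \<gamma>A(1)[OF Arr[OF f]] Arr_iff_Hom by metis
    have "G' (\<gamma> f) \<in> Hom M (F A) (F B)"
      using i(5)[OF f] \<gamma>A(2)[OF Arr[OF f]] by simp
    then have "F' (src L (\<gamma> f)) = F' (\<phi> A)" "F' (tgt L (\<gamma> f)) = F' (\<phi> B)"
      using i'(5)[OF h] \<phi>(2)[OF AB(1)] \<phi>(2)[OF AB(2)] by (simp_all add: Hom_def)
    then show ?thesis
      using F'_inj Hom_objects[OF h] \<phi>(1)[OF AB(1)] \<phi>(1)[OF AB(2)] h by metis
  qed
  have inj: "inj_on \<phi> (Obj L)"
    using bij_betw_imp_inj_on[OF i(2)] \<phi>(2) by (metis inj_on_def)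
  have comp: "\<gamma> (f \<cdot> g) = \<gamma> f \<cdot> \<gamma> g" if fg: "f \<in> Hom L A B" "g \<in> Hom L B C" for f g A B C
  proof (rule G'_inj)
    show "\<gamma> (f \<cdot> g) \<in> Arr L" using \<gamma>[OF comp_closed[OF fg]] Arr by blast
    show "\<gamma> f \<cdot> \<gamma> g \<in> Arr L" using comp_closed[OF \<gamma>[OF fg(1)] \<gamma>[OF fg(2)]] Arr by blast
    show "G' (\<gamma> (f \<cdot> g)) = G' (\<gamma> f \<cdot> \<gamma> g)"
      using \<gamma>A(2)[OF Arr[OF comp_closed[OF fg]]] i(6)[OF fg] i'(6)[OF \<gamma>[OF fg(1)] \<gamma>[OF fg(2)]]
        \<gamma>A(2)[OF Arr[OF fg(1)]] \<gamma>A(2)[OF Arr[OF fg(2)]] by simp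
  qed
  have prj: "\<gamma> (prj L A C B) = prj L (\<phi> A) (\<phi> C) (\<phi> B)"
    if o: "{A, B, C} \<subseteq> Obj L" and d: "distinct [A, B, C]" for A B C
  proof -
    have o': "{\<phi> A, \<phi> B, \<phi> C} \<subseteq> Obj L" using o \<phi>(1) by auto
    have d': "distinct [\<phi> A, \<phi> B, \<phi> C]" using o d inj by (auto dest: inj_onD)
    show ?thesis
    proof (rule G'_inj)
      show "\<gamma> (prj L A C B) \<in> Arr L" using \<gamma>A(1)[OF Arr[OF prj_in_Hom[OF o d]]] .
      show "prj L (\<phi> A) (\<phi> C) (\<phi> B) \<in> Arr L" using Arr[OF prj_in_Hom[OF o' d']] .
      show "G' (\<gamma> (prj L A C B)) = G' (prj L (\<phi> A) (\<phi> C) (\<phi> B))"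
        using \<gamma>A(2)[OF Arr[OF prj_in_Hom[OF o d]]] i(7)[OF o d] i'(7)[OF o' d'] \<phi>(2) o by simp
    qed
  qed
  have wt: "wt (\<gamma> \<mu>) = wt \<mu>" if "\<mu> \<in> Hom L A0 A0" for \<mu>
    using scal[OF that \<gamma>[OF that]] \<gamma>A(2)[OF Arr[OF that]] by simp
  have fix3: "\<phi> X = X" "\<phi> Y = Y" "\<phi> Z = Z"
    using F'_inj \<phi> XYZ by auto
  note fixed = endo_trivial_if_weight_fixed[of \<phi> \<gamma> A0 X Y Z]
  have "F A = F' A" if "A \<in> Obj L" for A
  proof -
    have "\<phi> A = A"
      by (rule fixed(1)[OF \<phi>(1) inj \<gamma> comp prj A0 wt XYZ(1,2) fix3 that])
    then show ?thesis using \<phi>(2)[OF that] by simp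
  qed
  moreover have "G f = G' f" if "f \<in> Arr L" for f
  proof -
    have "\<gamma> f = f"
      by (rule fixed(2)[OF \<phi>(1) inj \<gamma> comp prj A0 wt XYZ(1,2) fix3 that])
    then show ?thesis using \<gamma>A(2)[OF that] by simp
  qed
  ultimately show ?thesis
    using extensionalityI[OF i(1) i'(1)] extensionalityI[OF i(3) i'(3)] by blast
qed

end

section \<open>The coordinate isomorphism\<close>

context normalised_line
begin

definition coord_obj where
  "coord_obj = (\<lambda>A \<in> Obj L. span1 K (vec A))"

definition coord_arr where
  "coord_arr = (\<lambda>f \<in> Arr L. scale_arrow K (vec (src L f)) (wt f) (vec (tgt L f)))"

lemma vec_nonzero:
  assumes "A \<in> Obj L"
  shows "vec A \<in> carrier (plane K) - {\<zero>\<^bsub>plane K\<^esub>}"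
  using K.nonzero_vec_iff[of "vec A"] vec_closed[OF assms] by (simp add: vec_def)

lemma coord_arr:
  assumes "f \<in> Hom L A B"
  shows "coord_arr f = scale_arrow K (vec A) (wt f) (vec B)"
  using assms by (simp add: coord_arr_def Hom_def)

lemma coord_arr_closed:
  assumes f: "f \<in> Hom L A B"
  shows "coord_arr f \<in> Hom (proj_line K) (coord_obj A) (coord_obj B)"
  using K.scale_arrow_closed[OF vec_nonzero vec_nonzero wt_closed[OF f]] Hom_objects[OF f]
  by (simp add: coord_arr[OF f] coord_obj_def)

text \<open>The slopes run through every nonzero element of \<open>K\<close> exactly once, so the lines of the vectors
  \<open>(1, m)\<close>, together with those of the two basis vectors, are all lines.\<close>

lemma coord_obj_bij: "bij_betw coord_obj (Obj L) (lines K)"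
  unfolding bij_betw_def
proof
  show "inj_on coord_obj (Obj L)"
  proof (rule inj_onI, rule ccontr)
    fix A B assume AB: "A \<in> Obj L" "B \<in> Obj L" "coord_obj A = coord_obj B" "A \<noteq> B"
    then show False
      using det2_nonzero[of A B] K.span1_eq_iff_det2[OF vec_nonzero vec_nonzero, of A B]
      by (simp add: coord_obj_def)
  qed
  have "span1 K v \<in> coord_obj ` Obj L" if v: "v \<in> carrier (plane K) - {\<zero>\<^bsub>plane K\<^esub>}" for v
  proof -
    obtain a b where ab: "v = (a, b)" by (cases v)
    have cl: "a \<in> carrier K" "b \<in> carrier K" "a \<noteq> \<zero>\<^bsub>K\<^esub> \<or> b \<noteq> \<zero>\<^bsub>K\<^esub>"
      using v ab K.nonzero_vec_iff[of v] by simp_all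
    have "\<exists>D \<in> Obj L. det2 K v (vec D) = \<zero>\<^bsub>K\<^esub>"
    proof -
      consider "a = \<zero>\<^bsub>K\<^esub>" | "b = \<zero>\<^bsub>K\<^esub>" | "a \<noteq> \<zero>\<^bsub>K\<^esub>" "b \<noteq> \<zero>\<^bsub>K\<^esub>" by blast
      then show ?thesis
      proof cases
        case 1
        then show ?thesis using cl
          by (intro bexI[where x = X]) (simp_all add: vec_X det2_def ab K.minus_eq)
      next
        case 2
        then show ?thesis using cl
          by (intro bexI[where x = Y]) (simp_all add: vec_Y det2_def ab K.minus_eq)
      next
        case 3
        have i: "inv\<^bsub>K\<^esub> a \<in> carrier K" "a \<otimes>\<^bsub>K\<^esub> inv\<^bsub>K\<^esub> a = \<one>\<^bsub>K\<^esub>"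
          using cl 3 K.field_Units by auto
        have "inv\<^bsub>K\<^esub> a \<noteq> \<zero>\<^bsub>K\<^esub>" using i cl by auto
        then have "b \<otimes>\<^bsub>K\<^esub> inv\<^bsub>K\<^esub> a \<noteq> \<zero>\<^bsub>K\<^esub>"
          using 3 cl i(1) by (simp add: K.integral_iff)
        then obtain D where D: "D \<in> Obj L" "distinct [X, Y, D]" "slope D = b \<otimes>\<^bsub>K\<^esub> inv\<^bsub>K\<^esub> a"
          using slope_surj[of "b \<otimes>\<^bsub>K\<^esub> inv\<^bsub>K\<^esub> a"] cl i(1) by auto
        have "a \<otimes>\<^bsub>K\<^esub> (b \<otimes>\<^bsub>K\<^esub> inv\<^bsub>K\<^esub> a) = (a \<otimes>\<^bsub>K\<^esub> inv\<^bsub>K\<^esub> a) \<otimes>\<^bsub>K\<^esub> b"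
          using cl i(1) by algebra
        then have "det2 K v (vec D) = \<zero>\<^bsub>K\<^esub>"
          using cl i D(3) by (simp add: vec_other[OF D(2)] det2_def ab K.minus_eq K.r_neg)
        then show ?thesis using D(1) by blast
      qed
    qed
    then obtain D where D: "D \<in> Obj L" "det2 K v (vec D) = \<zero>\<^bsub>K\<^esub>" by blast
    then have "span1 K v = coord_obj D"
      using K.span1_eq_iff_det2[OF v vec_nonzero[OF D(1)]] by (simp add: coord_obj_def)
    then show ?thesis using D(1) by blast
  qed
  then have "lines K \<subseteq> coord_obj ` Obj L"
    unfolding lines_def by blast
  moreover have "coord_obj A \<in> lines K" if "A \<in> Obj L" for A
    unfolding K.lines_iff using vec_nonzero[OF that] that
    by (intro exI[where x = "vec A"]) (simp add: coord_obj_def)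
  ultimately show "coord_obj ` Obj L = lines K" by blast
qed

lemma coord_arr_bij: "bij_betw coord_arr (Arr L) (Arr (proj_line K))"
  unfolding bij_betw_def
proof
  show "inj_on coord_arr (Arr L)"
  proof (rule inj_onI)
    fix f g assume "f \<in> Arr L" "g \<in> Arr L" and eq: "coord_arr f = coord_arr g"
    then obtain A B A' B' where f: "f \<in> Hom L A B" and g: "g \<in> Hom L A' B'"
      using Arr_iff_Hom by metis
    note o = Hom_objects[OF f] Hom_objects[OF g]
    have "coord_obj A = coord_obj A'" "coord_obj B = coord_obj B'"
      using coord_arr_closed[OF f] coord_arr_closed[OF g] eq by (simp_all add: Hom_def)
    then have AB: "A = A'" "B = B'"
      using inj_onD[OF bij_betw_imp_inj_on[OF coord_obj_bij]] o by blast+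
    then have "wt f = wt g"
      using K.scale_arrow_inject[OF vec_nonzero[OF o(1)] vec_nonzero[OF o(2)]]
        wt_closed[OF f] wt_closed[OF g] coord_arr[OF f] coord_arr[OF g] eq by simp
    then show "f = g" using wt_inject f g AB by simp
  qed
  show "coord_arr ` Arr L = Arr (proj_line K)"
  proof
    show "coord_arr ` Arr L \<subseteq> Arr (proj_line K)"
      using coord_arr_closed Arr_iff_Hom by (fastforce simp: Hom_def)
    show "Arr (proj_line K) \<subseteq> coord_arr ` Arr L"
    proof
      fix h assume h: "h \<in> Arr (proj_line K)"
      have "src (proj_line K) h \<in> coord_obj ` Obj L" "tgt (proj_line K) h \<in> coord_obj ` Obj L"
        using h bij_betw_imp_surj_on[OF coord_obj_bij] by (auto simp: proj_line_def)
      then obtain A B where AB: "A \<in> Obj L" "B \<in> Obj L"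
        "src (proj_line K) h = coord_obj A" "tgt (proj_line K) h = coord_obj B"
        by (elim imageE)
      then have "h \<in> Hom (proj_line K) (span1 K (vec A)) (span1 K (vec B))"
        using h by (simp add: Hom_def coord_obj_def)
      then obtain r where r: "r \<in> carrier K" "r \<noteq> \<zero>\<^bsub>K\<^esub>" "h = scale_arrow K (vec A) r (vec B)"
        using K.scale_arrow_cases[OF vec_nonzero[OF AB(1)] vec_nonzero[OF AB(2)]] by blast
      then have "r \<in> wt ` Hom L A B"
        using bij_betw_imp_surj_on[OF wt_bij[OF AB(1,2)]] by simp
      then obtain f where f: "f \<in> Hom L A B" "wt f = r" by blast
      then have "h = coord_arr f" using coord_arr r(3) by simp
      then show "h \<in> coord_arr ` Arr L" using f(1) by (simp add: Hom_def)
    qed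
  qed
qed

text \<open>Functoriality holds because weights multiply; the determinant formula \<open>coef_det\<close> is what makes
  the labels match.\<close>

theorem coord_plc_iso: "(coord_obj, coord_arr) \<in> plc_iso L (proj_line K)"
proof -
  have "src (proj_line K) (coord_arr f) = coord_obj (src L f)"
    "tgt (proj_line K) (coord_arr f) = coord_obj (tgt L f)" if "f \<in> Arr L" for f
    using coord_arr_closed[of f "src L f" "tgt L f"] that by (simp_all add: Hom_def)
  moreover have "coord_arr (idn L A) = idn (proj_line K) (coord_obj A)" if A: "A \<in> Obj L" for A
    using coord_arr[OF idn_closed[OF A]] wt_idn[OF A] K.idn_eq_scale_arrow[OF vec_nonzero[OF A]] A
    by (simp add: coord_obj_def)
  moreover have "coord_arr (f \<cdot> g) = coord_arr f \<cdot>\<^bsub>proj_line K\<^esub> coord_arr g"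
    if "f \<in> Arr L" "g \<in> Arr L" "tgt L f = src L g" for f g
  proof -
    obtain A B C where f: "f \<in> Hom L A B" and g: "g \<in> Hom L B C"
      using \<open>f \<in> Arr L\<close> \<open>g \<in> Arr L\<close> \<open>tgt L f = src L g\<close> Arr_iff_Hom by metis
    show ?thesis
      using K.scale_arrow_comp[OF vec_nonzero vec_nonzero wt_closed(1)[OF f] wt_closed(1)[OF g]]
        Hom_objects[OF f] wt_comp[OF f g]
      by (simp add: coord_arr[OF f] coord_arr[OF g] coord_arr[OF comp_closed[OF f g]])
  qed
  moreover have "coord_arr (prj L A C B) = prj (proj_line K) (coord_obj A) (coord_obj C) (coord_obj B)"
    if o: "{A, B, C} \<subseteq> Obj L" and d: "distinct [A, B, C]" for A B C
  proof -
    have "prj (proj_line K) (span1 K (vec A)) (span1 K (vec C)) (span1 K (vec B))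
        = scale_arrow K (vec A) (coef A C B) (vec B)"
    proof (rule K.prj_eq_scale_arrow)
      show "coef A C B \<otimes>\<^bsub>K\<^esub> det2 K (vec B) (vec C) = det2 K (vec A) (vec C)"
        using coef_det[OF o d] .
      show "det2 K (vec B) (vec C) \<noteq> \<zero>\<^bsub>K\<^esub>" using det2_nonzero[of B C] o d by simp
    qed (use o vec_nonzero coef_closed[OF o d] in \<open>simp_all\<close>)
    then show ?thesis using coord_arr[OF prj_in_Hom[OF o d]] o by (simp add: coord_obj_def)
  qed
  moreover have "coord_obj \<in> extensional (Obj L)" "coord_arr \<in> extensional (Arr L)"
    by (simp_all add: coord_obj_def coord_arr_def)
  moreover have "bij_betw coord_obj (Obj L) (Obj (proj_line K))"
    using coord_obj_bij by (simp add: proj_line_def)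
  ultimately show ?thesis
    using coord_arr_bij by (simp add: plc_iso_def)
qed

theorem ex1_coordinate_iso:
  assumes A0: "A0 \<in> Obj L"
  shows "\<exists>!FG. FG \<in> plc_iso L (proj_line K) \<and>
    fst FG X = span1 K (\<zero>\<^bsub>K\<^esub>, \<one>\<^bsub>K\<^esub>) \<and> fst FG Y = span1 K (\<one>\<^bsub>K\<^esub>, \<zero>\<^bsub>K\<^esub>) \<and>
    fst FG Z = span1 K (\<one>\<^bsub>K\<^esub>, \<one>\<^bsub>K\<^esub>) \<and>
    (\<forall>\<mu> \<in> Hom L A0 A0. snd FG \<mu> = homothety K (wt \<mu>) (fst FG A0))"
proof (rule ex1I)
  have "coord_arr \<mu> = homothety K (wt \<mu>) (coord_obj A0)" if \<mu>: "\<mu> \<in> Hom L A0 A0" for \<mu>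
    using K.homothety_eq_scale_arrow[OF vec_nonzero[OF A0] wt_closed(1)[OF \<mu>]] coord_arr[OF \<mu>] A0
    by (simp add: coord_obj_def)
  then show "(coord_obj, coord_arr) \<in> plc_iso L (proj_line K) \<and>
    fst (coord_obj, coord_arr) X = span1 K (\<zero>\<^bsub>K\<^esub>, \<one>\<^bsub>K\<^esub>) \<and>
    fst (coord_obj, coord_arr) Y = span1 K (\<one>\<^bsub>K\<^esub>, \<zero>\<^bsub>K\<^esub>) \<and>
    fst (coord_obj, coord_arr) Z = span1 K (\<one>\<^bsub>K\<^esub>, \<one>\<^bsub>K\<^esub>) \<and>
    (\<forall>\<mu> \<in> Hom L A0 A0. snd (coord_obj, coord_arr) \<mu>
       = homothety K (wt \<mu>) (fst (coord_obj, coord_arr) A0))"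
    using coord_plc_iso by (simp add: coord_obj_def vec_X vec_Y vec_Z)
next
  fix FG assume *: "FG \<in> plc_iso L (proj_line K) \<and>
    fst FG X = span1 K (\<zero>\<^bsub>K\<^esub>, \<one>\<^bsub>K\<^esub>) \<and> fst FG Y = span1 K (\<one>\<^bsub>K\<^esub>, \<zero>\<^bsub>K\<^esub>) \<and>
    fst FG Z = span1 K (\<one>\<^bsub>K\<^esub>, \<one>\<^bsub>K\<^esub>) \<and>
    (\<forall>\<mu> \<in> Hom L A0 A0. snd FG \<mu> = homothety K (wt \<mu>) (fst FG A0))"
  obtain F G where FG: "FG = (F, G)" by (cases FG)
  have "(F, G) = (coord_obj, coord_arr)"
  proof (rule plc_iso_unique[OF _ coord_plc_iso A0 _ XYZ])
    fix \<mu> \<nu> A assume \<mu>: "\<mu> \<in> Hom L A0 A0" and \<nu>: "\<nu> \<in> Hom L A A" and eq: "G \<mu> = coord_arr \<nu>"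
    note v = vec_nonzero[OF Hom_objects(1)[OF \<nu>]]
    have G: "G \<mu> = homothety K (wt \<mu>) (F A0)" using * FG \<mu> by simp
    then have "F A0 = span1 K (vec A)"
      using eq by (simp add: coord_arr[OF \<nu>] homothety_def scale_arrow_def)
    then have "scale_arrow K (vec A) (wt \<mu>) (vec A) = scale_arrow K (vec A) (wt \<nu>) (vec A)"
      using G eq K.homothety_eq_scale_arrow[OF v wt_closed(1)[OF \<mu>]] coord_arr[OF \<nu>] by simp
    then show "wt \<mu> = wt \<nu>"
      using K.scale_arrow_inject[OF v v] wt_closed(1)[OF \<mu>] wt_closed(1)[OF \<nu>] by simp
  qed (use * FG in \<open>simp_all add: coord_obj_def vec_X vec_Y vec_Z\<close>)
  then show "FG = (coord_obj, coord_arr)" using FG by simp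
qed

end

section \<open>Weights from cross ratios\<close>

locale scalar_field = abstract_projective_line L + K: field K
  for L (structure) and K :: "'a option ring" +
  fixes A0
  assumes A0: "A0 \<in> Obj L"
    and carrier_K: "carrier K = insert None (Some ` Hom L A0 A0)"
    and zero_K: "\<zero>\<^bsub>K\<^esub> = None"
    and mult_K: "\<mu> \<in> Hom L A0 A0 \<Longrightarrow> \<nu> \<in> Hom L A0 A0 \<Longrightarrow> Some \<mu> \<otimes>\<^bsub>K\<^esub> Some \<nu> = Some (\<mu> \<cdot> \<nu>)"
    and Phi_K: "Some \<mu> \<in> carrier K - {\<zero>\<^bsub>K\<^esub>, \<one>\<^bsub>K\<^esub>} \<Longrightarrow> Some (Phi L A0 \<mu>) = \<one>\<^bsub>K\<^esub> \<ominus>\<^bsub>K\<^esub> Some \<mu>"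
begin

lemma one_K: "\<one>\<^bsub>K\<^esub> = Some (idn L A0)"
proof -
  let ?i = "idn L A0"
  note i = idn_closed[OF A0]
  have cl: "Some ?i \<in> carrier K" "Some ?i \<noteq> \<zero>\<^bsub>K\<^esub>"
    using i carrier_K zero_K by auto
  have "Some ?i \<otimes>\<^bsub>K\<^esub> Some ?i = Some ?i \<otimes>\<^bsub>K\<^esub> \<one>\<^bsub>K\<^esub>"
    using mult_K[OF i i] idn_left[OF i] cl by simp
  then show ?thesis
    using K.m_lcancel[OF cl(2,1,1) K.one_closed] by simp
qed

lemma cross_ratio_closed:
  assumes "{A, B, C, D} \<subseteq> Obj L" "distinct [A, B, C, D]"
  shows "cross_ratio L A B C D \<in> Hom L A A"
proof -
  have "prj L A C B \<in> Hom L A B" "prj L B D A \<in> Hom L B A"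
    using assms by (auto intro!: prj_in_Hom)
  then show ?thesis unfolding cross_ratio_def by (rule comp_closed)
qed

lemma cross_ratio_not_idn:
  assumes o: "{A, B, C, D} \<subseteq> Obj L" and d: "distinct [A, B, C, D]"
  shows "cross_ratio L A B C D \<noteq> idn L A"
proof
  assume "cross_ratio L A B C D = idn L A"
  then have "prj L A C B \<cdot> prj L B D A = prj L A C B \<cdot> prj L B C A"
    using Inv[of A B C] o d by (simp add: cross_ratio_def)
  then have "prj L B D A = prj L B C A"
    using cancel_left[OF prj_in_Hom[of A B C] prj_in_Hom[of B A D] prj_in_Hom[of B A C]] o d by auto
  then show False using prj_inject[of B A C D] o d by auto
qed

text \<open>Every nontrivial scalar is a cross ratio with \<open>B\<close> and \<open>C\<close> arbitrary: \<open>D\<close> is the label of the arrow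
  \<open>B \<rightarrow> A\<close> that completes \<open>A \<rightarrow> B\<close> with label \<open>C\<close> to the given scalar, and it differs from \<open>C\<close> since
  otherwise \<open>Inv\<close> would give the identity.\<close>

lemma cross_ratio_surj:
  assumes \<mu>: "\<mu> \<in> Hom L A A" "\<mu> \<noteq> idn L A"
  obtains B C D where "{A, B, C, D} \<subseteq> Obj L" "distinct [A, B, C, D]" "\<mu> = cross_ratio L A B C D"
proof -
  have A: "A \<in> Obj L" using Hom_objects[OF \<mu>(1)] by simp
  obtain B C where BC: "{B, C} \<subseteq> Obj L" "distinct [A, B, C]"
  proof -
    obtain P Q R where "{P, Q, R} \<subseteq> Obj L" "distinct [P, Q, R]"
      using three_objects by blast
    then show thesis
      using that[of P Q] that[of P R] that[of Q R] by auto
  qed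
  have AC: "prj L A C B \<in> Hom L A B" "prj L B C A \<in> Hom L B A"
    using BC A by (auto intro!: prj_in_Hom)
  have f: "prj L B C A \<cdot> \<mu> \<in> Hom L B A" using AC(2) \<mu>(1) by (rule comp_closed)
  obtain D where D: "D \<in> Obj L" "distinct [B, A, D]" "prj L B C A \<cdot> \<mu> = prj L B D A"
    using prj_cases[OF f] BC by auto
  have \<mu>_eq: "cross_ratio L A B C D = \<mu>"
    using D(3) comp_assoc[OF AC \<mu>(1)] Inv[of A B C] idn_left[OF \<mu>(1)] A BC
    by (simp add: cross_ratio_def)
  have "C \<noteq> D"
    using \<mu>_eq \<mu>(2) Inv[of A B C] A BC by (auto simp: cross_ratio_def)
  then show thesis using that[of B C D] \<mu>_eq A BC D by auto
qed

end

locale framed_scalar_field = scalar_field L K A0 + framed_groupoid L A0 e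
  for L (structure) and K and A0 and e
begin

abbreviation "wt f \<equiv> Some (frame_weight L e f)"

lemma wt_vertex: "\<mu> \<in> Hom L A0 A0 \<Longrightarrow> frame_weight L e \<mu> = \<mu>"
  by (rule frame_weight_vertex[OF vertex_comm[OF A0]])

lemma scalar_equiv_iff:
  assumes "\<mu> \<in> Hom L A A" "\<nu> \<in> Hom L B B"
  shows "scalar_equiv L A \<mu> B \<nu> \<longleftrightarrow> frame_weight L e \<mu> = frame_weight L e \<nu>"
  using scalar_equiv_iff_frame_weight[OF vertex_comm[OF A0] assms] .

lemma CR_weight:
  assumes o: "{A, B, C, D} \<subseteq> Obj L" "{A', B', C', D'} \<subseteq> Obj L"
    and d: "distinct [A, B, C, D]" "distinct [A', B', C', D']"
    and eq: "frame_weight L e (cross_ratio L A B C D) = frame_weight L e (cross_ratio L A' B' C' D')"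
  shows "frame_weight L e (cross_ratio L A C B D) = frame_weight L e (cross_ratio L A' C' B' D')"
proof -
  have "cross_ratio L A B C D \<in> Hom L A A" "cross_ratio L A' B' C' D' \<in> Hom L A' A'"
    "cross_ratio L A C B D \<in> Hom L A A" "cross_ratio L A' C' B' D' \<in> Hom L A' A'"
    using o d by (auto intro!: cross_ratio_closed)
  then show ?thesis
    using CR[of A B C D A' B' C' D'] o d eq scalar_equiv_iff by simp
qed

lemma Phi_cross_ratio:
  assumes o: "{B, C, D} \<subseteq> Obj L" and d: "distinct [A0, B, C, D]"
  shows "Phi L A0 (cross_ratio L A0 B C D) = cross_ratio L A0 C B D"
  unfolding Phi_def
proof (rule the_equality)
  fix \<nu> assume "\<exists>B' C' D'. {B', C', D'} \<subseteq> Obj L \<and> distinct [A0, B', C', D'] \<and>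
    cross_ratio L A0 B C D = cross_ratio L A0 B' C' D' \<and> \<nu> = cross_ratio L A0 C' B' D'"
  then obtain B' C' D' where p: "{B', C', D'} \<subseteq> Obj L" "distinct [A0, B', C', D']"
    "cross_ratio L A0 B C D = cross_ratio L A0 B' C' D'" "\<nu> = cross_ratio L A0 C' B' D'"
    by blast
  have "frame_weight L e (cross_ratio L A0 C' B' D') = frame_weight L e (cross_ratio L A0 C B D)"
    using CR_weight[of A0 B' C' D' A0 B C D] p o d A0 by simp
  moreover have "cross_ratio L A0 C' B' D' \<in> Hom L A0 A0" "cross_ratio L A0 C B D \<in> Hom L A0 A0"
    using p o d A0 by (auto intro!: cross_ratio_closed)
  ultimately show "\<nu> = cross_ratio L A0 C B D" using p(4) wt_vertex by simp
qed (rule exI[of _ B], rule exI[of _ C], rule exI[of _ D], simp only: o d simp_thms)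

text \<open>The hypothesis on \<open>\<Phi>\<close> concerns cross ratios based at \<open>A0\<close>. A cross ratio at another object has
  the same weight as some cross ratio at \<open>A0\<close>, and the axiom \<open>CR\<close> says that exchanging the
  middle points preserves this agreement.\<close>

lemma wt_cross_ratio_add:
  assumes o: "{A, B, C, D} \<subseteq> Obj L" and d: "distinct [A, B, C, D]"
  shows "wt (cross_ratio L A B C D) \<oplus>\<^bsub>K\<^esub> wt (cross_ratio L A C B D) = \<one>\<^bsub>K\<^esub>"
proof -
  define \<mu> where "\<mu> = frame_weight L e (cross_ratio L A B C D)"
  have A: "A \<in> Obj L" using o by simp
  note c = cross_ratio_closed[OF o d]
  have \<mu>: "\<mu> \<in> Hom L A0 A0" unfolding \<mu>_def using frame_weight_closed[OF c] .
  have i: "frame_weight L e (idn L A) = idn L A0"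
    using frame_weight_eq_iff[OF idn_closed[OF A] idn_closed[OF A0]]
      idn_right[OF frame[OF A]] idn_left[OF frame[OF A]] by simp
  have "\<mu> \<noteq> idn L A0"
    using inj_onD[OF bij_betw_imp_inj_on[OF frame_weight_bij[OF A A]] _ c idn_closed[OF A]]
      cross_ratio_not_idn[OF o d] i by (auto simp: \<mu>_def)
  then obtain B' C' D' where p: "{A0, B', C', D'} \<subseteq> Obj L" "distinct [A0, B', C', D']"
    "\<mu> = cross_ratio L A0 B' C' D'"
    using cross_ratio_surj[OF \<mu>] by metis
  have c': "cross_ratio L A0 C' B' D' \<in> Hom L A0 A0"
    using p by (auto intro!: cross_ratio_closed)
  have "frame_weight L e (cross_ratio L A C B D) = cross_ratio L A0 C' B' D'"
    using CR_weight[OF o p(1) d p(2)] p(3) \<mu> wt_vertex c' by (simp add: \<mu>_def)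
  also have "\<dots> = Phi L A0 \<mu>"
    using Phi_cross_ratio[of B' C' D'] p by simp
  finally have "wt (cross_ratio L A C B D) = \<one>\<^bsub>K\<^esub> \<ominus>\<^bsub>K\<^esub> Some \<mu>"
    using Phi_K[of \<mu>] \<mu> \<open>\<mu> \<noteq> idn L A0\<close> one_K zero_K carrier_K by auto
  moreover have "Some \<mu> \<in> carrier K" using \<mu> carrier_K by simp
  then have "Some \<mu> \<oplus>\<^bsub>K\<^esub> (\<one>\<^bsub>K\<^esub> \<ominus>\<^bsub>K\<^esub> Some \<mu>) = \<one>\<^bsub>K\<^esub>"
    using K.one_closed by algebra
  ultimately show ?thesis by (simp add: \<mu>_def)
qed

lemma weighted: "weighted_line L K (\<lambda>f. wt f)"
proof unfold_locales
  fix A B assume AB: "A \<in> Obj L" "B \<in> Obj L"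
  have Some_bij: "bij_betw Some (Hom L A0 A0) (carrier K - {\<zero>\<^bsub>K\<^esub>})"
    using carrier_K zero_K by (auto simp: bij_betw_def)
  show "bij_betw (\<lambda>f. wt f) (Hom L A B) (carrier K - {\<zero>\<^bsub>K\<^esub>})"
    using bij_betw_trans[OF frame_weight_bij[OF AB] Some_bij] by (simp add: o_def)
next
  fix f g A B C assume fg: "f \<in> Hom L A B" "g \<in> Hom L B C"
  show "wt (f \<cdot> g) = wt f \<otimes>\<^bsub>K\<^esub> wt g"
    using frame_weight_comp[OF fg] mult_K frame_weight_closed[OF fg(1)] frame_weight_closed[OF fg(2)]
    by simp
qed

end

context scalar_field
begin

text \<open>The two normalisations concern arrows that start at \<open>Y\<close>, one for each other object. So after an
  arbitrary choice of the frame at \<open>Y\<close> each of them prescribes the frame at one object.\<close>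

lemma ex_normalised_line:
  assumes XYZ: "{X, Y, Z} \<subseteq> Obj L" "distinct [X, Y, Z]"
  obtains wt where "normalised_line L K wt X Y Z" "\<And>\<mu>. \<mu> \<in> Hom L A0 A0 \<Longrightarrow> wt \<mu> = Some \<mu>"
proof -
  have o: "X \<in> Obj L" "Y \<in> Obj L" "Z \<in> Obj L" using XYZ by auto
  obtain t where t: "t \<in> Hom L A0 Y" using transitive[OF A0 o(2)] by blast
  have "\<ominus>\<^bsub>K\<^esub> \<one>\<^bsub>K\<^esub> \<in> carrier K" "\<ominus>\<^bsub>K\<^esub> \<one>\<^bsub>K\<^esub> \<noteq> \<zero>\<^bsub>K\<^esub>"
    by simp_all
  then obtain m where m: "m \<in> Hom L A0 A0" "\<ominus>\<^bsub>K\<^esub> \<one>\<^bsub>K\<^esub> = Some m"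
    using carrier_K zero_K by auto
  have YZX: "prj L Y Z X \<in> Hom L Y X" using XYZ by (auto intro!: prj_in_Hom)
  have YXD: "prj L Y X D \<in> Hom L Y D" if "D \<in> Obj L" "distinct [X, Y, D]" for D
    using XYZ that by (auto intro!: prj_in_Hom)
  \<comment> \<open>The values solve \<open>e Y \<cdot> prj L Y X D = e D\<close>, for the weight \<open>1\<close>, and
    \<open>e Y \<cdot> prj L Y Z X = m \<cdot> e X\<close>, for the weight \<open>-1\<close>.\<close>
  define e where "e D = (if D = Y then t
    else if D = X then arr_inv L m \<cdot> (t \<cdot> prj L Y Z X) else t \<cdot> prj L Y X D)" for D
  note tX = comp_closed[OF t YZX]
  have "e D \<in> Hom L A0 D" if "D \<in> Obj L" for D
    using t comp_closed[OF arr_inv_closed[OF m(1)] tX] comp_closed[OF t YXD[OF that]] XYZ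
    by (auto simp: e_def)
  then interpret framed_scalar_field L K A0 e
    by unfold_locales
  interpret weighted_line L K "\<lambda>f. wt f" by (rule weighted)
  have "frame_weight L e (prj L Y X D) = idn L A0" if D: "D \<in> Obj L" "distinct [X, Y, D]" for D
    using frame_weight_eq_iff[OF YXD[OF D] idn_closed[OF A0]] idn_left[OF comp_closed[OF t YXD[OF D]]] D
    by (auto simp: e_def)
  moreover have "m \<cdot> (arr_inv L m \<cdot> (t \<cdot> prj L Y Z X)) = t \<cdot> prj L Y Z X"
    using comp_assoc[OF m(1) arr_inv_closed[OF m(1)] tX] arr_inv_right[OF m(1)] idn_left[OF tX] by simp
  then have "frame_weight L e (prj L Y Z X) = m"
    using frame_weight_eq_iff[OF YZX m(1)] XYZ by (simp add: e_def)
  ultimately have "normalised_line L K (\<lambda>f. wt f) X Y Z"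
    using XYZ wt_cross_ratio_add m(2) one_K by unfold_locales simp_all
  then show thesis using that wt_vertex by simp
qed

end

section \<open>Comparison with the projective line over the scalars\<close>

theorem theorem1:
  fixes L :: "('o, 'a) labelled_groupoid"
    and A0 :: 'o
    and K :: "'a option ring"
  assumes "abstract_projective_line L"
    and "A0 \<in> Obj L"
    and "field K"
    and "carrier K = insert None (Some ` Hom L A0 A0)"
    and "\<zero>\<^bsub>K\<^esub> = None"
    and "\<And>\<mu> \<nu>. \<mu> \<in> Hom L A0 A0 \<Longrightarrow> \<nu> \<in> Hom L A0 A0 \<Longrightarrow>
           Some \<mu> \<otimes>\<^bsub>K\<^esub> Some \<nu> = Some (\<mu> \<cdot>\<^bsub>L\<^esub> \<nu>)"
    and "\<And>\<mu>. Some \<mu> \<in> carrier K - {\<zero>\<^bsub>K\<^esub>, \<one>\<^bsub>K\<^esub>} \<Longrightarrow>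
           Some (Phi L A0 \<mu>) = \<one>\<^bsub>K\<^esub> \<ominus>\<^bsub>K\<^esub> Some \<mu>"
  shows "plc_iso L (proj_line K) \<noteq> {} \<and>
    (\<forall>X Y Z. {X, Y, Z} \<subseteq> Obj L \<and> distinct [X, Y, Z] \<longrightarrow>
      (\<exists>!FG. FG \<in> plc_iso L (proj_line K) \<and>
         fst FG X = span1 K (\<zero>\<^bsub>K\<^esub>, \<one>\<^bsub>K\<^esub>) \<and>
         fst FG Y = span1 K (\<one>\<^bsub>K\<^esub>, \<zero>\<^bsub>K\<^esub>) \<and>
         fst FG Z = span1 K (\<one>\<^bsub>K\<^esub>, \<one>\<^bsub>K\<^esub>) \<and>
         (\<forall>\<mu> \<in> Hom L A0 A0. snd FG \<mu> = homothety K (Some \<mu>) (fst FG A0))))"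
proof -
  interpret L: abstract_projective_line L by (rule assms(1))
  interpret K: field K by (rule assms(3))
  interpret scalar_field L K A0
    using assms(2,4-7) by unfold_locales
  have ex1: "\<exists>!FG. FG \<in> plc_iso L (proj_line K) \<and>
      fst FG X = span1 K (\<zero>\<^bsub>K\<^esub>, \<one>\<^bsub>K\<^esub>) \<and> fst FG Y = span1 K (\<one>\<^bsub>K\<^esub>, \<zero>\<^bsub>K\<^esub>) \<and>
      fst FG Z = span1 K (\<one>\<^bsub>K\<^esub>, \<one>\<^bsub>K\<^esub>) \<and>
      (\<forall>\<mu> \<in> Hom L A0 A0. snd FG \<mu> = homothety K (Some \<mu>) (fst FG A0))"
    if XYZ: "{X, Y, Z} \<subseteq> Obj L" "distinct [X, Y, Z]" for X Y Z
  proof -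
    obtain wt where wt: "normalised_line L K wt X Y Z" "\<And>\<mu>. \<mu> \<in> Hom L A0 A0 \<Longrightarrow> wt \<mu> = Some \<mu>"
      using ex_normalised_line[OF XYZ] by blast
    show ?thesis
      using normalised_line.ex1_coordinate_iso[OF wt(1) A0] wt(2) by (simp cong: ball_cong)
  qed
  obtain X Y Z where XYZ: "{X, Y, Z} \<subseteq> Obj L" "distinct [X, Y, Z]"
    using L.three_objects by blast
  show ?thesis
  proof (intro conjI allI impI)
    show "plc_iso L (proj_line K) \<noteq> {}"
      using ex1_implies_ex[OF ex1[OF XYZ]] by (elim exE conjE) (rule ex_in_conv[THEN iffD1], rule exI)
  next
    fix X Y Z assume "{X, Y, Z} \<subseteq> Obj L \<and> distinct [X, Y, Z]"
    then show "\<exists>!FG. FG \<in> plc_iso L (proj_line K) \<and>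
        fst FG X = span1 K (\<zero>\<^bsub>K\<^esub>, \<one>\<^bsub>K\<^esub>) \<and> fst FG Y = span1 K (\<one>\<^bsub>K\<^esub>, \<zero>\<^bsub>K\<^esub>) \<and>
        fst FG Z = span1 K (\<one>\<^bsub>K\<^esub>, \<one>\<^bsub>K\<^esub>) \<and>
        (\<forall>\<mu> \<in> Hom L A0 A0. snd FG \<mu> = homothety K (Some \<mu>) (fst FG A0))"
      by (elim conjE) (rule ex1)
  qed
qed

end
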